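(* Let $G$ be an Artin group of large type, and let $X=\{x_1,\dots,x_n\}^{\pm1}$ be its standard generating set, equipped with a total ordering. Then $\mathsf{ConjSL}(G,X)$ is not regular.
   Context: An Artin group is a group with presentation $\langle x_1,\dots,x_n \mid {}_{m_{ij}}(x_i,x_j)={}_{m_{ij}}(x_j,x_i)\text{ for each } i\ne j\rangle$, where $(m_{ij})$ is a symmetric $n\times n$ matrix with entries in $\mathbb{N}\cup\{\infty\}$, $m_{ii}=1$, $m_{ij}\ge 2$ for $i\neq j$, and ${}_m(a,a')$ denotes the word of length $m$ in alternating $a$'s and $a'$'s starting with $a$ (no relation is imposed when $m_{ij}=\infty$). It has large type if $m_{ij}\ge 3$ for all $i\ne j$. Given a total ordering of $X$, the shortlex ordering on the set $X^*$ of words over $X$ compares words first by length and then, for equal length, lexicographically. For each conjugacy class $c$ of $G$, $z_c$ denotes the shortlex least word over $X$ representing an element of $c$, and $\mathsf{ConjSL}(G,X)=\{z_c : c \text{ a conjugacy class of } G\}$. A language (a subset of $X^*$) is regular if it is accepted by a finite state automaton.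
   Formalization: The formal theorem assumes at least two generators (n ≥ 2); for n = 0 (trivial group) and n = 1 (infinite cyclic group, ConjSL = x* ∪ (x⁻¹)* ) the language is regular, so the claim fails there. *)

theory Defs
  imports "HOL-Algebra.Group_Action" "HOL-Library.Extended_Nat"
begin

section \<open>Groups given by presentations\<close>

text \<open>
  The letter \<open>(a, True)\<close> stands for the generator \<open>a\<close>, the letter \<open>(a, False)\<close> for its formal
  inverse. Words over \<open>S\<^sup>\<plusminus>\<close> are the lists over \<open>letters S\<close>.
\<close>

type_synonym 'a letter = "'a \<times> bool"
type_synonym 'a word = "'a letter list"

definition letters :: "'a set \<Rightarrow> 'a letter set" where
  "letters S = S \<times> UNIV"

definition inv_letter :: "'a letter \<Rightarrow> 'a letter" where
  "inv_letter x = (fst x, \<not> snd x)"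

definition inv_word :: "'a word \<Rightarrow> 'a word" where
  "inv_word w = rev (map inv_letter w)"

text \<open>Equality in \<open>\<langle>S | u = v for (u, v) \<in> R\<rangle>\<close>: the congruence on words generated by the
  relations and by the cancellation of inverse pairs.\<close>

inductive pres_eq :: "'a set \<Rightarrow> ('a word \<times> 'a word) set \<Rightarrow> 'a word \<Rightarrow> 'a word \<Rightarrow> bool"
  for S R where
  relation: "(u, v) \<in> R \<Longrightarrow> pres_eq S R u v"
| cancel: "x \<in> letters S \<Longrightarrow> pres_eq S R [x, inv_letter x] []"
| refl: "u \<in> lists (letters S) \<Longrightarrow> pres_eq S R u u"
| sym: "pres_eq S R u v \<Longrightarrow> pres_eq S R v u"
| trans: "pres_eq S R u v \<Longrightarrow> pres_eq S R v w \<Longrightarrow> pres_eq S R u w"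
| append: "pres_eq S R u v \<Longrightarrow> pres_eq S R u' v' \<Longrightarrow> pres_eq S R (u @ u') (v @ v')"

definition word_class :: "'a set \<Rightarrow> ('a word \<times> 'a word) set \<Rightarrow> 'a word \<Rightarrow> 'a word set" where
  "word_class S R w = {v. pres_eq S R w v}"

definition presented_group ::
    "'a set \<Rightarrow> ('a word \<times> 'a word) set \<Rightarrow> 'a word set monoid" where
  "presented_group S R =
    \<lparr>carrier = word_class S R ` lists (letters S),
     mult = (\<lambda>A B. {w. \<exists>u\<in>A. \<exists>v\<in>B. pres_eq S R (u @ v) w}),
     one = word_class S R []\<rparr>"

context
  fixes S :: "'a set" and R :: "('a word \<times> 'a word) set"
  assumes R: "R \<subseteq> lists (letters S) \<times> lists (letters S)"
begin

lemma inv_letter_in: "x \<in> letters S \<Longrightarrow> inv_letter x \<in> letters S"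
  by (auto simp: letters_def inv_letter_def)

lemma inv_word_in: "w \<in> lists (letters S) \<Longrightarrow> inv_word w \<in> lists (letters S)"
  by (auto simp: inv_word_def in_lists_conv_set inv_letter_in)

lemma pres_eq_in: "pres_eq S R u v \<Longrightarrow> u \<in> lists (letters S) \<and> v \<in> lists (letters S)"
  by (induction rule: pres_eq.induct) (use R in \<open>auto simp: inv_letter_in\<close>)

lemma word_class_eq_iff:
  assumes "v \<in> lists (letters S)"
  shows "word_class S R u = word_class S R v \<longleftrightarrow> pres_eq S R u v"
proof
  assume "word_class S R u = word_class S R v"
  then show "pres_eq S R u v"
    using pres_eq.refl[OF assms, of R] unfolding word_class_def by blast
next
  assume "pres_eq S R u v"
  then show "word_class S R u = word_class S R v"
    unfolding word_class_def by (auto intro: pres_eq.trans pres_eq.trans[OF pres_eq.sym])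
qed

lemma mult_word_class:
  assumes "u \<in> lists (letters S)" "v \<in> lists (letters S)"
  shows "word_class S R u \<otimes>\<^bsub>presented_group S R\<^esub> word_class S R v = word_class S R (u @ v)"
proof -
  have "(\<exists>u'. pres_eq S R u u' \<and> (\<exists>v'. pres_eq S R v v' \<and> pres_eq S R (u' @ v') w)) \<longleftrightarrow>
      pres_eq S R (u @ v) w" for w
    using pres_eq.append[of S R u _ v] pres_eq.trans[of S R "u @ v" _ w]
      pres_eq.refl[OF assms(1), of R] pres_eq.refl[OF assms(2), of R] by blast
  then show ?thesis
    by (simp add: presented_group_def word_class_def Bex_def)
qed

lemma inv_word_left:
  "w \<in> lists (letters S) \<Longrightarrow> pres_eq S R (inv_word w @ w) []"
proof (induction w)
  case Nil
  show ?case by (auto simp: inv_word_def intro: pres_eq.refl)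
next
  case (Cons x w)
  then have x: "x \<in> letters S" and w: "w \<in> lists (letters S)" by auto
  have "pres_eq S R [inv_letter x, x] []"
    using pres_eq.cancel[OF inv_letter_in[OF x], of R] by (simp add: inv_letter_def)
  then have "pres_eq S R ([inv_letter x, x] @ w) ([] @ w)"
    using pres_eq.refl[OF w] by (rule pres_eq.append)
  then have "pres_eq S R (inv_word w @ [inv_letter x, x] @ w) (inv_word w @ [] @ w)"
    by (rule pres_eq.append[OF pres_eq.refl[OF inv_word_in[OF w]]])
  then have "pres_eq S R (inv_word (x # w) @ x # w) (inv_word w @ w)"
    by (simp add: inv_word_def)
  then show ?case
    by (rule pres_eq.trans[OF _ Cons.IH[OF w]])
qed

lemma group_presented_group: "group (presented_group S R)"
proof (rule groupI)
  let ?G = "presented_group S R"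
  have carr: "carrier ?G = word_class S R ` lists (letters S)"
    and one: "\<one>\<^bsub>?G\<^esub> = word_class S R []"
    by (simp_all add: presented_group_def)
  show "\<one>\<^bsub>?G\<^esub> \<in> carrier ?G"
    unfolding carr one by blast
  show "x \<otimes>\<^bsub>?G\<^esub> y \<in> carrier ?G" if xy: "x \<in> carrier ?G" "y \<in> carrier ?G" for x y
  proof -
    obtain u v where "u \<in> lists (letters S)" "v \<in> lists (letters S)"
      "x = word_class S R u" "y = word_class S R v"
      using xy unfolding carr by blast
    moreover from this have "u @ v \<in> lists (letters S)" by simp
    ultimately show ?thesis
      unfolding carr by (simp only: mult_word_class imageI)
  qed
  show "x \<otimes>\<^bsub>?G\<^esub> y \<otimes>\<^bsub>?G\<^esub> z = x \<otimes>\<^bsub>?G\<^esub> (y \<otimes>\<^bsub>?G\<^esub> z)"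
    if xyz: "x \<in> carrier ?G" "y \<in> carrier ?G" "z \<in> carrier ?G" for x y z
  proof -
    obtain u v w where "u \<in> lists (letters S)" "v \<in> lists (letters S)" "w \<in> lists (letters S)"
      "x = word_class S R u" "y = word_class S R v" "z = word_class S R w"
      using xyz unfolding carr by blast
    moreover from this have "u @ v \<in> lists (letters S)" "v @ w \<in> lists (letters S)" by simp_all
    ultimately show ?thesis
      by (simp only: mult_word_class append_assoc)
  qed
  show "\<one>\<^bsub>?G\<^esub> \<otimes>\<^bsub>?G\<^esub> x = x" if "x \<in> carrier ?G" for x
  proof -
    obtain u where "u \<in> lists (letters S)" "x = word_class S R u"
      using \<open>x \<in> carrier ?G\<close> unfolding carr by blast
    then show ?thesis
      by (simp only: one mult_word_class lists.Nil append_Nil)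
  qed
  show "\<exists>y\<in>carrier ?G. y \<otimes>\<^bsub>?G\<^esub> x = \<one>\<^bsub>?G\<^esub>" if "x \<in> carrier ?G" for x
  proof -
    obtain w where w: "w \<in> lists (letters S)" "x = word_class S R w"
      using \<open>x \<in> carrier ?G\<close> unfolding carr by blast
    have "word_class S R (inv_word w) \<otimes>\<^bsub>?G\<^esub> x = \<one>\<^bsub>?G\<^esub>"
      unfolding w(2) one mult_word_class[OF inv_word_in[OF w(1)] w(1)]
      using inv_word_left[OF w(1)] by (simp only: word_class_eq_iff lists.Nil)
    then show ?thesis
      using inv_word_in[OF w(1)] unfolding carr by blast
  qed
qed

end

section \<open>Artin groups\<close>

fun alternating :: "nat \<Rightarrow> 'b \<Rightarrow> 'b \<Rightarrow> 'b list" where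
  "alternating 0 a b = []"
| "alternating (Suc k) a b = a # alternating k b a"

text \<open>The generators are indexed by \<open>{1..n}\<close>; only the entries \<open>m i j\<close> with \<open>i, j \<in> {1..n}\<close>
  matter.\<close>

definition coxeter_matrix :: "nat \<Rightarrow> (nat \<Rightarrow> nat \<Rightarrow> enat) \<Rightarrow> bool" where
  "coxeter_matrix n m \<longleftrightarrow>
    (\<forall>i\<in>{1..n}. m i i = 1) \<and>
    (\<forall>i\<in>{1..n}. \<forall>j\<in>{1..n}. m i j = m j i) \<and>
    (\<forall>i\<in>{1..n}. \<forall>j\<in>{1..n}. i \<noteq> j \<longrightarrow> m i j \<ge> 2)"

definition large_type :: "nat \<Rightarrow> (nat \<Rightarrow> nat \<Rightarrow> enat) \<Rightarrow> bool" where
  "large_type n m \<longleftrightarrow> (\<forall>i\<in>{1..n}. \<forall>j\<in>{1..n}. i \<noteq> j \<longrightarrow> m i j \<ge> 3)"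

definition artin_relations ::
    "nat \<Rightarrow> (nat \<Rightarrow> nat \<Rightarrow> enat) \<Rightarrow> (nat word \<times> nat word) set" where
  "artin_relations n m =
    {(alternating k (i, True) (j, True), alternating k (j, True) (i, True)) | i j k.
      i \<in> {1..n} \<and> j \<in> {1..n} \<and> i \<noteq> j \<and> m i j = enat k}"

definition artin_group :: "nat \<Rightarrow> (nat \<Rightarrow> nat \<Rightarrow> enat) \<Rightarrow> nat word set monoid" where
  "artin_group n m = presented_group {1..n} (artin_relations n m)"

text \<open>The element of the Artin group represented by a word.\<close>

definition artin_elem :: "nat \<Rightarrow> (nat \<Rightarrow> nat \<Rightarrow> enat) \<Rightarrow> nat word \<Rightarrow> nat word set" where
  "artin_elem n m = word_class {1..n} (artin_relations n m)"

lemma set_alternating: "set (alternating k a b) \<subseteq> {a, b}"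
  by (induction k arbitrary: a b) auto

lemma artin_relations_words:
  "artin_relations n m \<subseteq> lists (letters {1..n}) \<times> lists (letters {1..n})"
proof -
  have "alternating k (i, True) (j, True) \<in> lists (letters {1..n})"
    if "i \<in> {1..n}" "j \<in> {1..n}" for i j k
    unfolding lists_eq_set letters_def mem_Collect_eq
    by (rule order_trans[OF set_alternating]) (use that in simp)
  then show ?thesis
    unfolding artin_relations_def by blast
qed

lemma group_artin_group: "group (artin_group n m)"
  unfolding artin_group_def by (rule group_presented_group[OF artin_relations_words])

section \<open>Conjugacy classes and their shortlex representatives\<close>

definition conjugacy_classes :: "('g, 'b) monoid_scheme \<Rightarrow> 'g set set" where
  "conjugacy_classes G =
    orbits G (carrier G) (\<lambda>g. \<lambda>h \<in> carrier G. g \<otimes>\<^bsub>G\<^esub> h \<otimes>\<^bsub>G\<^esub> inv\<^bsub>G\<^esub> g)"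

text \<open>Here \<open>r\<close> is a reflexive linear order on the alphabet, whereas \<^const>\<open>lenlex\<close> expects
  a strict one.\<close>

definition shortlex :: "('a \<times> 'a) set \<Rightarrow> ('a list \<times> 'a list) set" where
  "shortlex r = (lenlex (r - Id))\<^sup>="

definition shortlex_least :: "('a \<times> 'a) set \<Rightarrow> 'a list set \<Rightarrow> 'a list \<Rightarrow> bool" where
  "shortlex_least r L w \<longleftrightarrow> w \<in> L \<and> (\<forall>v\<in>L. (w, v) \<in> shortlex r)"

definition ConjSL ::
    "nat \<Rightarrow> (nat \<Rightarrow> nat \<Rightarrow> enat) \<Rightarrow> (nat letter \<times> nat letter) set \<Rightarrow> nat word set" where
  "ConjSL n m r =
    {z. \<exists>c \<in> conjugacy_classes (artin_group n m).
      shortlex_least r {w \<in> lists (letters {1..n}). artin_elem n m w \<in> c} z}"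

section \<open>Regular languages\<close>

text \<open>A language over the alphabet \<open>X\<close> is regular if it is accepted by a complete deterministic
  automaton with finite state set \<open>Q\<close>, initial state \<open>q\<^sub>0\<close>, final states \<open>F\<close> and transition function
  \<open>\<delta>\<close>. As \<open>Q\<close> is finite, it is no restriction to take the states from the natural numbers.\<close>

definition regular_language :: "'x set \<Rightarrow> 'x list set \<Rightarrow> bool" where
  "regular_language X L \<longleftrightarrow>
    (\<exists>(Q :: nat set) q\<^sub>0 F \<delta>.
      finite Q \<and> q\<^sub>0 \<in> Q \<and> F \<subseteq> Q \<and> (\<forall>q\<in>Q. \<forall>x\<in>X. \<delta> q x \<in> Q) \<and>
      L = {w \<in> lists X. foldl \<delta> q\<^sub>0 w \<in> F})"

end

theory Submission
  imports Defs Complex_Main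
begin

text \<open>
  A positive word has minimal length among the words representing its conjugacy class, and the
  words of that length are again positive. They are compared by the trace of the deformed
  reflection representation (parameter \<open>s\<close>, with \<open>q = s\<^sup>2\<close>) of the Artin group. Take
  \<open>w = (x\<^sup>i y\<^sup>i)\<^sup>2\<close> where \<open>2 cos (\<pi> / m x y)\<close> is maximal, and let \<open>z\<close> be the shortlex least word of its class.

  As \<open>s \<rightarrow> \<infinity>\<close>, the trace of a positive word of length \<open>L\<close> with \<open>k\<close> cyclic changes of letter grows at
  most like \<open>s\<close> to the power \<open>2 L - k\<close>, while for \<open>w\<close> (where \<open>k = 4\<close>) this order is attained; so \<open>z\<close> has at
  most four syllables. At \<open>s = \<i>\<close> the generators become transvections and the real part of the trace
  is an explicit polynomial in the syllable lengths. By the inequality of arithmetic and geometric means,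
  \<open>z\<close> can only reach the trace of \<open>w\<close> if \<open>z = (a\<^sup>i b\<^sup>i)\<^sup>2\<close> for letters \<open>a < b\<close>.

  So \<open>(a\<^sup>i b\<^sup>i)\<^sup>2\<close> is in the language for infinitely many \<open>i\<close> and fixed \<open>a < b\<close>. A finite automaton
  would then accept some \<open>a\<^sup>i b\<^sup>j a\<^sup>j b\<^sup>j\<close> with \<open>i < j\<close>, which is greater than its cyclic permutation
  \<open>a\<^sup>j b\<^sup>j a\<^sup>i b\<^sup>j\<close>.
\<close>

section \<open>Conjugacy of words in a presented group\<close>

lemma inv_word_append: "inv_word (u @ v) = inv_word v @ inv_word u"
  by (simp add: inv_word_def)

lemma inv_word_inv_word: "inv_word (inv_word u) = u"
  by (simp add: inv_word_def inv_letter_def rev_map o_def)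

locale presentation =
  fixes S :: "'a set" and R :: "('a word \<times> 'a word) set"
  assumes R_words: "R \<subseteq> lists (letters S) \<times> lists (letters S)"
begin

abbreviation words :: "'a word set" where "words \<equiv> lists (letters S)"
abbreviation eqv :: "'a word \<Rightarrow> 'a word \<Rightarrow> bool" (infix "\<sim>" 50) where "u \<sim> v \<equiv> pres_eq S R u v"
abbreviation cls :: "'a word \<Rightarrow> 'a word set" where "cls \<equiv> word_class S R"
abbreviation G where "G \<equiv> presented_group S R"

definition conj_words :: "'a word \<Rightarrow> 'a word \<Rightarrow> bool" where
  "conj_words u v \<longleftrightarrow> (\<exists>g\<in>words. g @ u @ inv_word g \<sim> v)"

lemmas inv_word_words = inv_word_in[OF R_words]

lemma inv_word_right: "w \<in> words \<Longrightarrow> w @ inv_word w \<sim> []"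
  using inv_word_left[OF R_words inv_word_words] by (simp add: inv_word_inv_word)

lemma eqv_context:
  assumes "u \<sim> v" "x \<in> words" "y \<in> words"
  shows "x @ u @ y \<sim> x @ v @ y"
  using assms by (intro pres_eq.append pres_eq.refl)

lemma cls_eq_iff: "v \<in> words \<Longrightarrow> cls u = cls v \<longleftrightarrow> u \<sim> v"
  by (rule word_class_eq_iff[OF R_words])

lemma conj_words_refl: "u \<in> words \<Longrightarrow> conj_words u u"
  unfolding conj_words_def by (intro bexI[of _ "[]"]) (auto simp: inv_word_def intro: pres_eq.refl)

lemma conj_words_sym:
  assumes "conj_words u v" "u \<in> words" shows "conj_words v u"
proof -
  obtain g where g: "g \<in> words" "g @ u @ inv_word g \<sim> v"
    using assms unfolding conj_words_def by blast
  have ig: "inv_word g \<in> words" using g(1) by (rule inv_word_words)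
  have "inv_word g @ v @ g \<sim> inv_word g @ (g @ u @ inv_word g) @ g"
    using eqv_context[OF pres_eq.sym[OF g(2)] ig g(1)] .
  also have "inv_word g @ (g @ u @ inv_word g) @ g = (inv_word g @ g) @ u @ (inv_word g @ g)" by simp
  finally have 1: "inv_word g @ v @ g \<sim> \<dots>" .
  have "(inv_word g @ g) @ u @ (inv_word g @ g) \<sim> [] @ u @ []"
    using inv_word_left[OF R_words g(1)] assms(2) by (intro pres_eq.append pres_eq.refl)
  then have "inv_word g @ v @ g \<sim> u" using 1 pres_eq.trans by fastforce
  then show ?thesis
    unfolding conj_words_def using ig by (intro bexI[of _ "inv_word g"]) (simp_all add: inv_word_inv_word)
qed

lemma conj_words_trans:
  assumes "conj_words u v" "conj_words v w" shows "conj_words u w"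
proof -
  obtain g h where g: "g \<in> words" "g @ u @ inv_word g \<sim> v" and h: "h \<in> words" "h @ v @ inv_word h \<sim> w"
    using assms unfolding conj_words_def by blast
  have "h @ (g @ u @ inv_word g) @ inv_word h \<sim> w"
    using eqv_context[OF g(2) h(1) inv_word_words[OF h(1)]] h(2) pres_eq.trans by metis
  then show ?thesis
    unfolding conj_words_def using g h by (intro bexI[of _ "h @ g"]) (simp_all add: inv_word_append)
qed

lemma conj_words_rotate:
  assumes "u \<in> words" "v \<in> words" shows "conj_words (u @ v) (v @ u)"
proof -
  have "v @ u @ v @ inv_word v \<sim> v @ u @ []"
    using assms inv_word_right by (intro pres_eq.append pres_eq.refl)
  then show ?thesis
    unfolding conj_words_def using assms by (intro bexI[of _ v]) simp_all
qed

section \<open>Conjugation orbits in terms of words\<close>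

lemma inv_cls:
  assumes "g \<in> words" shows "inv\<^bsub>G\<^esub> (cls g) = cls (inv_word g)"
proof -
  interpret group G by (rule group_presented_group[OF R_words])
  have c: "cls w \<in> carrier G" if "w \<in> words" for w
    using that by (simp add: presented_group_def)
  have "cls (inv_word g) \<otimes>\<^bsub>G\<^esub> cls g = \<one>\<^bsub>G\<^esub>"
    using mult_word_class[OF R_words inv_word_words[OF assms] assms]
      cls_eq_iff[of "[]"] inv_word_left[OF R_words assms] by (simp add: presented_group_def)
  then show ?thesis
    using c assms inv_word_words inv_equality by blast
qed

lemma conj_cls:
  assumes "g \<in> words" "u \<in> words"
  shows "cls g \<otimes>\<^bsub>G\<^esub> cls u \<otimes>\<^bsub>G\<^esub> inv\<^bsub>G\<^esub> (cls g) = cls (g @ u @ inv_word g)"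
  using assms by (simp add: inv_cls mult_word_class[OF R_words] inv_word_words)

lemma orbit_cls:
  assumes "h \<in> words"
  shows "orbit G (\<lambda>g. \<lambda>h \<in> carrier G. g \<otimes>\<^bsub>G\<^esub> h \<otimes>\<^bsub>G\<^esub> inv\<^bsub>G\<^esub> g) (cls h) = cls ` {v \<in> words. conj_words h v}"
proof -
  have carr: "carrier G = cls ` words" by (simp add: presented_group_def)
  have "orbit G (\<lambda>g. \<lambda>h \<in> carrier G. g \<otimes>\<^bsub>G\<^esub> h \<otimes>\<^bsub>G\<^esub> inv\<^bsub>G\<^esub> g) (cls h) =
      {cls (g @ h @ inv_word g) | g. g \<in> words}"
    using assms conj_cls[OF _ assms]
    by (simp add: orbit_def carr setcompr_eq_image image_image cong: image_cong_simp)
  also have "\<dots> = cls ` {v \<in> words. conj_words h v}"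
  proof (intro equalityI subsetI)
    fix C assume "C \<in> {cls (g @ h @ inv_word g) | g. g \<in> words}"
    then obtain g where g: "g \<in> words" "C = cls (g @ h @ inv_word g)" by blast
    then have "g @ h @ inv_word g \<in> words" using assms inv_word_words by simp
    then show "C \<in> cls ` {v \<in> words. conj_words h v}"
      unfolding g(2) conj_words_def using g(1) pres_eq.refl by blast
  next
    fix C assume "C \<in> cls ` {v \<in> words. conj_words h v}"
    then obtain v g where "v \<in> words" "C = cls v" "g \<in> words" "g @ h @ inv_word g \<sim> v"
      unfolding conj_words_def by blast
    then show "C \<in> {cls (g @ h @ inv_word g) | g. g \<in> words}"
      using cls_eq_iff by blast
  qed
  finally show ?thesis .
qed

lemma conj_class_words:
  assumes "h \<in> words"
  shows "{w \<in> words. cls w \<in> cls ` {v \<in> words. conj_words h v}} = {w \<in> words. conj_words h w}"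
proof -
  have "conj_words h w" if w: "w \<in> words" "cls w = cls v" "v \<in> words" "conj_words h v" for v w
  proof -
    have "v \<sim> w" using w cls_eq_iff[of w v] by simp
    then show ?thesis
      using w(4) pres_eq.trans unfolding conj_words_def by blast
  qed
  then show ?thesis by blast
qed

text \<open>This moves the language from orbits in the quotient group to \<open>conj_words\<close>.
  A shortlex least word lies in its own class, so by symmetry and transitivity it can itself serve
  as the base point \<open>h\<close>.\<close>

lemma shortlex_least_class_iff:
  "(\<exists>c \<in> conjugacy_classes G. shortlex_least r {w \<in> words. cls w \<in> c} z) \<longleftrightarrow>
    shortlex_least r {w \<in> words. conj_words z w} z"
proof -
  have carr: "carrier G = cls ` words" by (simp add: presented_group_def)
  have "(\<exists>c \<in> conjugacy_classes G. shortlex_least r {w \<in> words. cls w \<in> c} z) \<longleftrightarrow>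
      (\<exists>h \<in> words. shortlex_least r {w \<in> words. conj_words h w} z)"
    using orbit_cls conj_class_words
    by (simp add: conjugacy_classes_def orbits_def carr setcompr_eq_image image_image cong: image_cong_simp)
  also have "\<dots> \<longleftrightarrow> shortlex_least r {w \<in> words. conj_words z w} z"
  proof
    assume "\<exists>h \<in> words. shortlex_least r {w \<in> words. conj_words h w} z"
    then obtain h where h: "h \<in> words" "shortlex_least r {w \<in> words. conj_words h w} z" by blast
    then have z: "z \<in> words" "conj_words h z" by (auto simp: shortlex_least_def)
    have "conj_words h w \<longleftrightarrow> conj_words z w" for w
      using z h(1) conj_words_sym conj_words_trans by blast
    then show "shortlex_least r {w \<in> words. conj_words z w} z" using h(2) by simp
  qed (auto simp: shortlex_least_def)
  finally show ?thesis .
qed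

end

section \<open>Positive words and the exponent sum\<close>

definition pos_word :: "'a list \<Rightarrow> 'a word" where
  "pos_word = map (\<lambda>x. (x, True))"

lemma pos_word_simps [simp]:
  "pos_word [] = []"
  "pos_word (x # xs) = (x, True) # pos_word xs"
  "pos_word (xs @ ys) = pos_word xs @ pos_word ys"
  "pos_word (replicate k x) = replicate k (x, True)"
  "length (pos_word xs) = length xs"
  by (simp_all add: pos_word_def)

lemma pos_word_in_iff [simp]: "pos_word xs \<in> lists (letters S) \<longleftrightarrow> xs \<in> lists S"
  by (induction xs) (auto simp: letters_def)

text \<open>The homomorphism to the integers sending every generator to 1. It respects the braid
  relations because their two sides have equal length.\<close>

definition exponent_sum :: "'a word \<Rightarrow> int" where
  "exponent_sum w = (\<Sum>l\<leftarrow>w. if snd l then 1 else - 1)"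

lemma exponent_sum_simps [simp]:
  "exponent_sum [] = 0"
  "exponent_sum (l # w) = (if snd l then 1 else - 1) + exponent_sum w"
  "exponent_sum (v @ w) = exponent_sum v + exponent_sum w"
  "exponent_sum (inv_word w) = - exponent_sum w"
  "exponent_sum (pos_word zs) = int (length zs)"
proof -
  show "exponent_sum (inv_word w) = - exponent_sum w"
    by (induction w) (auto simp: exponent_sum_def inv_word_def inv_letter_def)
  show "exponent_sum (pos_word zs) = int (length zs)"
    by (induction zs) (auto simp: exponent_sum_def)
qed (simp_all add: exponent_sum_def)

lemma exponent_sum_le: "exponent_sum w \<le> int (length w)"
  by (induction w) auto

text \<open>Each negative letter makes the exponent sum fall short of the length by 2, so equality
  leaves only positive letters.\<close>

lemma pos_word_of_exponent_sum: "exponent_sum w = int (length w) \<Longrightarrow> w = pos_word (map fst w)"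
proof (induction w)
  case (Cons l w)
  then show ?case
    using exponent_sum_le[of w] by (cases l) (auto split: if_splits)
qed simp

lemma exponent_sum_cong:
  assumes "pres_eq S R u v" "\<And>x y. (x, y) \<in> R \<Longrightarrow> exponent_sum x = exponent_sum y"
  shows "exponent_sum u = exponent_sum v"
  using assms(1) by (induction rule: pres_eq.induct) (auto simp: assms(2) inv_letter_def)

lemma exponent_sum_alternating: "exponent_sum (alternating k (i, True) (j, True)) = int k"
  by (induction k arbitrary: i j) auto

section \<open>The deformed reflection representation\<close>

text \<open>For \<open>s = 1\<close> and \<open>K u v = 2 * cos (pi / m u v)\<close> off the
  diagonal this is twice the bilinear form of the Coxeter group.\<close>

definition gram :: "(nat \<Rightarrow> nat \<Rightarrow> real) \<Rightarrow> complex \<Rightarrow> nat \<Rightarrow> nat \<Rightarrow> complex" where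
  "gram K s u v = (if u = v then 1 + s\<^sup>2 else - of_real (K u v) * s)"

definition root_form ::
    "nat \<Rightarrow> (nat \<Rightarrow> nat \<Rightarrow> real) \<Rightarrow> complex \<Rightarrow> nat \<Rightarrow> (nat \<Rightarrow> complex) \<Rightarrow> complex" where
  "root_form n K s u v = (\<Sum>w\<in>{1..n}. gram K s u w * v w)"

text \<open>The coefficient \<open>c\<close> is left free so that a generator
  (\<open>c = 1\<close>), its inverse (\<open>c = 1 / s^2\<close>) and its powers are all of this
  shape. For \<open>c = 1\<close> the basis vector at \<open>u\<close> is an eigenvector with
  eigenvalue \<open>- s^2\<close>.\<close>

definition reflection ::
    "nat \<Rightarrow> (nat \<Rightarrow> nat \<Rightarrow> real) \<Rightarrow> complex \<Rightarrow> complex \<Rightarrow> nat \<Rightarrow> (nat \<Rightarrow> complex) \<Rightarrow> nat \<Rightarrow> complex" where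
  "reflection n K s c u v = v(u := v u - c * root_form n K s u v)"

definition rep ::
    "nat \<Rightarrow> (nat \<Rightarrow> nat \<Rightarrow> real) \<Rightarrow> complex \<Rightarrow> nat word \<Rightarrow> (nat \<Rightarrow> complex) \<Rightarrow> nat \<Rightarrow> complex" where
  "rep n K s = foldr (\<lambda>(u, b). reflection n K s (if b then 1 else 1 / s\<^sup>2) u)"

definition basis_vec :: "nat \<Rightarrow> nat \<Rightarrow> complex" where
  "basis_vec u w = (if w = u then 1 else 0)"

definition op_trace :: "nat \<Rightarrow> ((nat \<Rightarrow> complex) \<Rightarrow> nat \<Rightarrow> complex) \<Rightarrow> complex" where
  "op_trace n f = (\<Sum>x\<in>{1..n}. f (basis_vec x) x)"

context
  fixes n :: nat and K :: "nat \<Rightarrow> nat \<Rightarrow> real" and s :: complex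
begin

lemma root_form_basis: "v \<in> {1..n} \<Longrightarrow> root_form n K s u (basis_vec v) = gram K s u v"
  by (simp add: root_form_def basis_vec_def if_distrib cong: if_cong)

lemma root_form_add:
  "root_form n K s u (\<lambda>w. f w + c * g w) = root_form n K s u f + c * root_form n K s u g"
  by (simp add: root_form_def sum.distrib sum_distrib_left algebra_simps)

lemma root_form_upd:
  assumes "a \<in> {1..n}"
  shows "root_form n K s u (v(a := v a - d)) = root_form n K s u v - d * gram K s u a"
proof -
  have "v(a := v a - d) = (\<lambda>w. v w + (- d) * basis_vec a w)"
    by (auto simp: basis_vec_def)
  then show ?thesis
    using root_form_add[of u v "- d" "basis_vec a"] root_form_basis[OF assms] by simp
qed

lemma reflection_zero [simp]: "reflection n K s 0 u v = v"
  by (simp add: reflection_def)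

text \<open>The eigenvalue at the basis vector of \<open>u\<close> is
  \<open>1 - c * (1 + s^2)\<close>, and these eigenvalues multiply under composition.\<close>

lemma reflection_reflection:
  assumes "u \<in> {1..n}"
  shows "reflection n K s c u (reflection n K s d u v) = reflection n K s (c + d - c * d * (1 + s\<^sup>2)) u v"
proof -
  have "root_form n K s u (reflection n K s d u v) = root_form n K s u v * (1 - d * (1 + s\<^sup>2))"
    using root_form_upd[OF assms, of u v "d * root_form n K s u v"]
    by (simp add: reflection_def gram_def algebra_simps)
  then have "reflection n K s c u (reflection n K s d u v) =
      v(u := v u - d * root_form n K s u v - c * (root_form n K s u v * (1 - d * (1 + s\<^sup>2))))"
    unfolding reflection_def[of n K s c] by (simp add: reflection_def)
  then show ?thesis
    by (simp add: reflection_def algebra_simps)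
qed

lemma reflection_inverse:
  assumes "u \<in> {1..n}" "s \<noteq> 0"
  shows "reflection n K s 1 u (reflection n K s (1 / s\<^sup>2) u v) = v" "reflection n K s (1 / s\<^sup>2) u (reflection n K s 1 u v) = v"
  using assms by (simp_all add: reflection_reflection field_simps)

lemma rep_simps [simp]:
  "rep n K s [] v = v"
  "rep n K s ((u, b) # w) v = reflection n K s (if b then 1 else 1 / s\<^sup>2) u (rep n K s w v)"
  "rep n K s (w @ w') v = rep n K s w (rep n K s w' v)"
  by (simp_all add: rep_def)

text \<open>The coefficient of a power is a geometric sum in \<open>- s^2\<close>. At
  \<open>s = \<i>\<close> it is the exponent \<open>e\<close> itself, which makes syllable lengths
  visible in the trace.\<close>

lemma rep_replicate:
  assumes "u \<in> {1..n}"
  shows "rep n K s (replicate e (u, True)) v = reflection n K s (\<Sum>k<e. (- s\<^sup>2) ^ k) u v"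
proof (induction e)
  case (Suc e)
  let ?C = "\<Sum>k<e. (- s\<^sup>2) ^ k"
  have "(\<Sum>k<Suc e. (- s\<^sup>2) ^ k) = 1 + (- s\<^sup>2) * ?C"
    by (simp only: sum.lessThan_Suc_shift sum_distrib_left power_Suc power_0)
  also have "\<dots> = 1 + ?C - 1 * ?C * (1 + s\<^sup>2)"
    by (simp add: algebra_simps)
  finally show ?case
    using assms by (simp add: Suc reflection_reflection del: sum.lessThan_Suc)
qed simp

section \<open>Linearity, matrix products and traces\<close>

lemma reflection_linear:
  "reflection n K s c u (\<lambda>w. f w + a * g w) = (\<lambda>w. reflection n K s c u f w + a * reflection n K s c u g w)"
  by (auto simp: reflection_def root_form_add algebra_simps)

lemma rep_linear:
  "rep n K s w (\<lambda>x. f x + a * g x) = (\<lambda>x. rep n K s w f x + a * rep n K s w g x)"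
  by (induction w) (auto simp: reflection_linear)

lemma rep_zero [simp]: "rep n K s w (\<lambda>x. 0) = (\<lambda>x. 0)"
  by (induction w) (auto simp: reflection_def root_form_def)

lemma rep_sum:
  "finite A \<Longrightarrow> rep n K s w (\<lambda>x. \<Sum>y\<in>A. c y * g y x) = (\<lambda>x. \<Sum>y\<in>A. c y * rep n K s w (g y) x)"
proof (induction A rule: finite_induct)
  case (insert a A)
  then show ?case
    using rep_linear[of w "\<lambda>x. \<Sum>y\<in>A. c y * g y x" "c a" "g a"] by (simp add: add.commute)
qed simp

lemma rep_support:
  assumes "w \<in> lists (letters {1..n})" "x \<notin> {1..n}"
  shows "rep n K s w v x = v x"
  using assms by (induction w) (auto simp: reflection_def letters_def)

text \<open>Matrix multiplication. By \<open>rep_support\<close> the image of a basis vector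
  vanishes outside \<open>{1..n}\<close>, so it is a finite combination of basis vectors.\<close>

lemma rep_expand:
  assumes "w' \<in> lists (letters {1..n})" "y \<in> {1..n}"
  shows "rep n K s w (rep n K s w' (basis_vec y)) x =
    (\<Sum>z\<in>{1..n}. rep n K s w' (basis_vec y) z * rep n K s w (basis_vec z) x)"
proof -
  have "rep n K s w' (basis_vec y) z = (\<Sum>a\<in>{1..n}. rep n K s w' (basis_vec y) a * basis_vec a z)" for z
  proof (cases "z \<in> {1..n}")
    case True
    then show ?thesis by (simp add: basis_vec_def if_distrib cong: if_cong)
  next
    case False
    have "(\<Sum>a\<in>{1..n}. rep n K s w' (basis_vec y) a * basis_vec a z) = 0"
      using False by (intro sum.neutral) (auto simp: basis_vec_def)
    moreover have "basis_vec y z = 0" using False assms(2) by (auto simp: basis_vec_def)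
    ultimately show ?thesis using rep_support[OF assms(1) False] by simp
  qed
  then have "rep n K s w' (basis_vec y) =
      (\<lambda>z. \<Sum>a\<in>{1..n}. rep n K s w' (basis_vec y) a * basis_vec a z)" by blast
  then show ?thesis using rep_sum[of "{1..n}" w "rep n K s w' (basis_vec y)" basis_vec] by simp
qed

lemma op_trace_rep_commute:
  assumes "u \<in> lists (letters {1..n})" "v \<in> lists (letters {1..n})"
  shows "op_trace n (rep n K s (u @ v)) = op_trace n (rep n K s (v @ u))"
proof -
  have "op_trace n (rep n K s (u @ v)) =
      (\<Sum>x\<in>{1..n}. \<Sum>z\<in>{1..n}. rep n K s v (basis_vec x) z * rep n K s u (basis_vec z) x)"
    using rep_expand[OF assms(2)] by (simp add: op_trace_def)
  also have "\<dots> = (\<Sum>z\<in>{1..n}. \<Sum>x\<in>{1..n}. rep n K s u (basis_vec z) x * rep n K s v (basis_vec x) z)"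
    by (subst sum.swap) (simp add: mult.commute)
  also have "\<dots> = op_trace n (rep n K s (v @ u))"
    using rep_expand[OF assms(1)] by (simp add: op_trace_def)
  finally show ?thesis .
qed

text \<open>Each factor is the identity minus an operator of rank one. Expanding the product gives
  one term for each subset of the four factors: a signed cyclic product of Gram entries, with
  \<open>n\<close> for the empty subset. The roots may coincide.\<close>

lemma op_trace_reflection4:
  assumes "{u1, u2, u3, u4} \<subseteq> {1..n}"
  defines "g \<equiv> gram K s"
  shows "op_trace n (\<lambda>v. reflection n K s c1 u1 (reflection n K s c2 u2 (reflection n K s c3 u3 (reflection n K s c4 u4 v)))) =
    of_nat n - (c1 * g u1 u1 + c2 * g u2 u2 + c3 * g u3 u3 + c4 * g u4 u4)
    + (c1 * c2 * g u1 u2 * g u2 u1 + c1 * c3 * g u1 u3 * g u3 u1 + c1 * c4 * g u1 u4 * g u4 u1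
      + c2 * c3 * g u2 u3 * g u3 u2 + c2 * c4 * g u2 u4 * g u4 u2 + c3 * c4 * g u3 u4 * g u4 u3)
    - (c1 * c2 * c3 * g u1 u2 * g u2 u3 * g u3 u1 + c1 * c2 * c4 * g u1 u2 * g u2 u4 * g u4 u1
      + c1 * c3 * c4 * g u1 u3 * g u3 u4 * g u4 u1 + c2 * c3 * c4 * g u2 u3 * g u3 u4 * g u4 u2)
    + c1 * c2 * c3 * c4 * g u1 u2 * g u2 u3 * g u3 u4 * g u4 u1"
proof -
  \<comment> \<open>\<open>d1\<close> to \<open>d4\<close> are the amounts that the four factors
    subtract at their own coordinates, starting from the basis vector of \<open>x\<close>; the
    factor of \<open>u4\<close> acts first.\<close>
  define d4 where "d4 x = c4 * g u4 x" for x
  define d3 where "d3 x = c3 * (g u3 x - d4 x * g u3 u4)" for x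
  define d2 where "d2 x = c2 * (g u2 x - d4 x * g u2 u4 - d3 x * g u2 u3)" for x
  define d1 where "d1 x = c1 * (g u1 x - d4 x * g u1 u4 - d3 x * g u1 u3 - d2 x * g u1 u2)" for x
  have *: "reflection n K s c1 u1 (reflection n K s c2 u2 (reflection n K s c3 u3 (reflection n K s c4 u4 (basis_vec x)))) x =
      1 - (if x = u1 then d1 x else 0) - (if x = u2 then d2 x else 0)
      - (if x = u3 then d3 x else 0) - (if x = u4 then d4 x else 0)" if "x \<in> {1..n}" for x
  proof -
    let ?v4 = "(basis_vec x)(u4 := basis_vec x u4 - d4 x)"
    let ?v3 = "?v4(u3 := ?v4 u3 - d3 x)"
    let ?v2 = "?v3(u2 := ?v3 u2 - d2 x)"
    let ?v1 = "?v2(u1 := ?v2 u1 - d1 x)"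
    note r = root_form_upd[of u4 _ "basis_vec x"] root_form_upd[of u3 _ ?v4] root_form_upd[of u2 _ ?v3]
    have "reflection n K s c4 u4 (basis_vec x) = ?v4"
      using that by (simp add: reflection_def root_form_basis d4_def g_def)
    moreover have "reflection n K s c3 u3 ?v4 = ?v3"
      using that assms(1) r(1)[of u3] by (simp add: reflection_def root_form_basis d3_def g_def)
    moreover have "reflection n K s c2 u2 ?v3 = ?v2"
      using that assms(1) r(1)[of u2] r(2)[of u2] by (simp add: reflection_def root_form_basis d2_def g_def)
    moreover have "reflection n K s c1 u1 ?v2 = ?v1"
      using that assms(1) r(1)[of u1] r(2)[of u1] r(3)[of u1]
      by (simp add: reflection_def root_form_basis d1_def g_def)
    ultimately have "reflection n K s c1 u1 (reflection n K s c2 u2 (reflection n K s c3 u3 (reflection n K s c4 u4 (basis_vec x)))) = ?v1"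
      by simp
    then show ?thesis by (simp add: basis_vec_def)
  qed
  have "op_trace n (\<lambda>v. reflection n K s c1 u1 (reflection n K s c2 u2 (reflection n K s c3 u3 (reflection n K s c4 u4 v)))) =
      (\<Sum>x\<in>{1..n}. 1 - (if x = u1 then d1 x else 0) - (if x = u2 then d2 x else 0)
      - (if x = u3 then d3 x else 0) - (if x = u4 then d4 x else 0))"
    unfolding op_trace_def by (intro sum.cong HOL.refl *)
  also have "\<dots> = of_nat n - d1 u1 - d2 u2 - d3 u3 - d4 u4"
    unfolding sum_subtractf using assms(1) by simp
  finally have "op_trace n (\<lambda>v. reflection n K s c1 u1 (reflection n K s c2 u2 (reflection n K s c3 u3 (reflection n K s c4 u4 v)))) =
      of_nat n - d1 u1 - d2 u2 - d3 u3 - d4 u4" .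
  then show ?thesis
    by (simp add: d1_def d2_def d3_def d4_def algebra_simps)
qed

lemma rep_cong:
  assumes "pres_eq {1..n} R u v" "s \<noteq> 0"
    and "\<And>x y v. (x, y) \<in> R \<Longrightarrow> rep n K s x v = rep n K s y v"
  shows "rep n K s u x = rep n K s v x"
  using assms(1)
proof (induction arbitrary: x rule: pres_eq.induct)
  case (cancel l)
  then show ?case
    using reflection_inverse[OF _ assms(2)] by (cases l) (auto simp: letters_def inv_letter_def)
qed (use assms(3) in auto)

end

section \<open>Braid relations\<close>

text \<open>With \<open>x, y\<close> the values of the root forms of \<open>i, j\<close> at \<open>v\<close>, the alternating product of length \<open>k\<close>
  sends \<open>v\<close> to \<open>v + (a x + c y) e\<^sub>i + (b y + d x) e\<^sub>j\<close>, where \<open>(a, b, c, d)\<close> are the following coefficients.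
  Then \<open>(a - b) \<plusminus> (c - d)\<close> satisfy Chebyshev recurrences in \<open>k\<close>, so both vanish when \<open>sin (k \<theta>) = 0\<close>.\<close>

fun braid_coeffs :: "real \<Rightarrow> complex \<Rightarrow> nat \<Rightarrow> complex \<times> complex \<times> complex \<times> complex" where
  "braid_coeffs \<kappa> s 0 = (0, 0, 0, 0)"
| "braid_coeffs \<kappa> s (Suc k) = (case braid_coeffs \<kappa> s k of (a, b, c, d) \<Rightarrow>
    (- 1 - s\<^sup>2 * b + of_real \<kappa> * s * c, a, of_real \<kappa> * s * a - s\<^sup>2 * d, c))"

text \<open>Removing the first letter exchanges \<open>i\<close> and \<open>j\<close>, which is why
  \<open>braid_coeffs\<close> shifts the old \<open>a\<close> and \<open>c\<close> into the places
  of \<open>b\<close> and \<open>d\<close>. The new letter changes only coordinate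
  \<open>i\<close>.\<close>

lemma rep_alternating:
  assumes "{i, j} \<subseteq> {1..n}" "i \<noteq> j" "K i j = \<kappa>" "K j i = \<kappa>" "braid_coeffs \<kappa> s k = (a, b, c, d)"
  shows "rep n K s (alternating k (i, True) (j, True)) v =
    (let x = root_form n K s i v; y = root_form n K s j v
     in v(i := v i + (a * x + c * y), j := v j + (b * y + d * x)))"
  using assms
proof (induction k arbitrary: i j a b c d)
  case (Suc k)
  obtain a' b' c' d' where k: "braid_coeffs \<kappa> s k = (a', b', c', d')" by (cases "braid_coeffs \<kappa> s k")
  define x where "x = root_form n K s i v"
  define y where "y = root_form n K s j v"
  have eqs: "a = - 1 - s\<^sup>2 * b' + of_real \<kappa> * s * c'" "b = a'" "c = of_real \<kappa> * s * a' - s\<^sup>2 * d'" "d = c'"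
    using Suc.prems(5) k by auto
  let ?u = "v(j := v j - (- (a' * y + c' * x)))"
  let ?w = "?u(i := ?u i - (- (b' * x + d' * y)))"
  have w: "rep n K s (alternating k (j, True) (i, True)) v = ?w"
    using Suc.IH[of j i a' b' c' d'] Suc.prems k by (simp add: Let_def x_def y_def fun_eq_iff)
  have "root_form n K s i ?w = x + (a' * y + c' * x) * gram K s i j + (b' * x + d' * y) * gram K s i i"
  proof -
    have "root_form n K s i ?w = root_form n K s i ?u - (- (b' * x + d' * y)) * gram K s i i"
      using Suc.prems(1) by (intro root_form_upd) auto
    moreover have "root_form n K s i ?u = x - (- (a' * y + c' * x)) * gram K s i j"
      unfolding x_def using Suc.prems(1) by (intro root_form_upd) auto
    ultimately show ?thesis by (simp only: minus_mult_left[symmetric] diff_minus_eq_add)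
  qed
  also have "\<dots> = x - (a' * y + c' * x) * (of_real \<kappa> * s) + (b' * x + d' * y) * (1 + s\<^sup>2)"
    using Suc.prems by (simp add: gram_def)
  finally have f: "root_form n K s i ?w = \<dots>" .
  have "rep n K s (alternating (Suc k) (i, True) (j, True)) v = ?w(i := ?w i - 1 * root_form n K s i ?w)"
    by (simp only: alternating.simps rep_simps(2) w if_True reflection_def[of n K s 1 i ?w])
  then show ?case
    unfolding Let_def x_def[symmetric] y_def[symmetric] f using Suc.prems(2)
    by (simp add: eqs fun_eq_iff algebra_simps)
qed (simp add: Let_def)

text \<open>This is \<open>f k = c * s ^ (k - 1) * sin (k * \<theta>) / sin \<theta>\<close> with
  the denominators cleared; the recurrence is the addition formula for the sine.\<close>

lemma chebyshev_recurrence: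
  fixes f :: "nat \<Rightarrow> complex" and \<theta> :: real
  assumes "f 0 = 0" "f 1 = c" "\<And>k. f (Suc (Suc k)) = of_real (2 * cos \<theta>) * s * f (Suc k) - s\<^sup>2 * f k"
  shows "s * of_real (sin \<theta>) * f k = c * s ^ k * of_real (sin (k * \<theta>))"
proof (induction k rule: less_induct)
  case (less k)
  consider "k = 0" | "k = 1" | l where "k = Suc (Suc l)"
    by (metis One_nat_def not0_implies_Suc)
  then show ?case
  proof cases
    case 3
    have "sin (real k * \<theta>) = 2 * cos \<theta> * sin (real (Suc l) * \<theta>) - sin (real l * \<theta>)"
    proof -
      have k: "real k * \<theta> = real (Suc l) * \<theta> + \<theta>" and l: "real l * \<theta> = real (Suc l) * \<theta> - \<theta>"
        using 3 by (simp_all add: algebra_simps)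
      show ?thesis unfolding k l by (simp add: sin_add sin_diff)
    qed
    then have sin_k: "complex_of_real (sin (real k * \<theta>)) =
        of_real (2 * cos \<theta>) * of_real (sin (real (Suc l) * \<theta>)) - of_real (sin (real l * \<theta>))"
      by (simp only: of_real_mult of_real_diff)
    define S0 where "S0 = complex_of_real (sin (real l * \<theta>))"
    define S1 where "S1 = complex_of_real (sin (real (Suc l) * \<theta>))"
    have IH: "s * of_real (sin \<theta>) * f l = c * s ^ l * S0" "s * of_real (sin \<theta>) * f (Suc l) = c * s ^ Suc l * S1"
      unfolding S0_def S1_def by (rule less; simp add: 3)+
    have "s * of_real (sin \<theta>) * f k = of_real (2 * cos \<theta>) * s * (s * of_real (sin \<theta>) * f (Suc l))
        - s\<^sup>2 * (s * of_real (sin \<theta>) * f l)"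
      unfolding 3 assms(3) by (simp add: algebra_simps)
    also have "\<dots> = c * s ^ k * of_real (sin (k * \<theta>))"
      unfolding sin_k IH S0_def[symmetric] S1_def[symmetric]
      by (simp add: 3 power2_eq_square algebra_simps)
    finally show ?thesis .
  qed (use assms in auto)
qed

lemma braid_coeffs_eq:
  fixes \<theta> :: real
  assumes "s \<noteq> 0" "sin \<theta> \<noteq> 0" "sin (k * \<theta>) = 0" "braid_coeffs (2 * cos \<theta>) s k = (a, b, c, d)"
  shows "a = b" "c = d"
proof -
  let ?B = "braid_coeffs (2 * cos \<theta>) s"
  define f where "f k = (case ?B k of (a, b, c, d) \<Rightarrow> (a - b) + (c - d))" for k
  define g where "g k = (case ?B k of (a, b, c, d) \<Rightarrow> (a - b) - (c - d))" for k
  have "f (Suc (Suc l)) = of_real (2 * cos \<theta>) * s * f (Suc l) - s\<^sup>2 * f l" for l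
    by (simp add: f_def split: prod.splits) (simp add: algebra_simps)
  \<comment> \<open>Changing the sign of \<open>c - d\<close> amounts to replacing \<open>s\<close>
    by \<open>- s\<close> in the recurrence.\<close>
  moreover have "g (Suc (Suc l)) = of_real (2 * cos \<theta>) * (- s) * g (Suc l) - (- s)\<^sup>2 * g l" for l
    by (simp add: g_def split: prod.splits) (simp add: algebra_simps)
  moreover have "f 0 = 0" "f 1 = - 1" "g 0 = 0" "g 1 = - 1" by (simp_all add: f_def g_def)
  ultimately have "f k = 0" "g k = 0"
    using chebyshev_recurrence[of f "- 1" \<theta> s k] chebyshev_recurrence[of g "- 1" \<theta> "- s" k] assms(1-3)
    by auto
  then have "(a - b) + (c - d) = 0" "(a - b) - (c - d) = 0"
    using assms(4) by (simp_all add: f_def g_def)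
  then have "((a - b) + (c - d)) + ((a - b) - (c - d)) = 0" "((a - b) + (c - d)) - ((a - b) - (c - d)) = 0"
    by simp_all
  then show "a = b" "c = d" by simp_all
qed

text \<open>Once \<open>a = b\<close> and \<open>c = d\<close>, the formula of
  \<open>rep_alternating\<close> is symmetric in \<open>i\<close> and \<open>j\<close>.\<close>

lemma rep_braid:
  fixes \<theta> :: real
  assumes "{i, j} \<subseteq> {1..n}" "i \<noteq> j" "K i j = 2 * cos \<theta>" "K j i = 2 * cos \<theta>"
    and "s \<noteq> 0" "sin \<theta> \<noteq> 0" "sin (k * \<theta>) = 0"
  shows "rep n K s (alternating k (i, True) (j, True)) v = rep n K s (alternating k (j, True) (i, True)) v"
proof -
  obtain a b c d where k: "braid_coeffs (2 * cos \<theta>) s k = (a, b, c, d)" by (metis surj_pair)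
  have "a = b" "c = d" using braid_coeffs_eq[OF assms(5-7) k] by simp_all
  then show ?thesis
    using rep_alternating[of i j n K _ s k a b c d v] rep_alternating[of j i n K _ s k a b c d v] assms k
    by (simp add: Let_def fun_eq_iff)
qed

section \<open>Growth of traces of positive words\<close>

fun changes :: "'a list \<Rightarrow> nat" where
  "changes (x # y # zs) = (if x = y then 0 else 1) + changes (y # zs)"
| "changes zs = 0"

lemma changes_insert: "zs \<noteq> [] \<Longrightarrow> changes (x # u # zs) \<le> changes (x # zs) + 2"
  by (cases zs) auto

lemma changes_replace: "zs \<noteq> [] \<Longrightarrow> changes (u # zs) \<le> (if u = w then 0 else 1) + changes (w # zs)"
  by (cases zs) auto

text \<open>Expanding the product over the set of letters at which the rank-one summand is chosen: omitting a
  letter costs \<open>t\<^sup>2\<close> and saves at most two changes, each of which costs \<open>t\<close>.\<close>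

lemma rep_pos_bound:
  fixes t :: real
  assumes "t \<ge> 1" and K: "\<And>u v. \<bar>K u v\<bar> \<le> 2" and "set zs \<subseteq> {1..n}" "x \<in> {1..n}"
  shows "cmod (rep n K (of_real t) (pos_word zs) (basis_vec y) x) * t ^ changes (x # zs @ [y]) \<le>
    (1 + 2 * real n) ^ length zs * t ^ (2 * length zs)"
  using assms(3,4)
proof (induction zs arbitrary: x)
  case Nil
  then show ?case by (simp add: basis_vec_def)
next
  case (Cons u zs)
  let ?M = "\<lambda>x. rep n K (of_real t) (pos_word zs) (basis_vec y) x"
  let ?B = "(1 + 2 * real n) ^ length zs * t ^ (2 * length zs)"
  have IH: "cmod (?M x) * t ^ changes (x # zs @ [y]) \<le> ?B" if "x \<in> {1..n}" for x
    using Cons that by simp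
  have B0: "0 \<le> ?B" using assms(1) by simp
  have u: "u \<in> {1..n}" using Cons.prems by simp
  have goal: "?B * (t ^ 2 * (1 + 2 * real n)) = (1 + 2 * real n) ^ length (u # zs) * t ^ (2 * length (u # zs))"
    by (simp add: power_add power2_eq_square algebra_simps)
  show ?case
  proof (cases "x = u")
    case False
    \<comment> \<open>The reflection at \<open>u\<close> leaves coordinate \<open>x\<close> alone,
      so this letter is omitted; the additional factor \<open>t^2\<close> in the bound pays for the
      two changes that may be lost.\<close>
    have "changes (x # u # zs @ [y]) \<le> changes (x # zs @ [y]) + 2"
      by (rule changes_insert) simp
    then have "cmod (?M x) * t ^ changes (x # (u # zs) @ [y]) \<le> cmod (?M x) * (t ^ changes (x # zs @ [y]) * t ^ 2)"
      unfolding power_add[symmetric] using assms(1) by (intro mult_left_mono power_increasing) auto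
    also have "\<dots> \<le> ?B * t ^ 2"
      using IH[OF Cons.prems(2)] by (simp add: mult.assoc[symmetric] mult_right_mono)
    also have "\<dots> \<le> ?B * (t ^ 2 * (1 + 2 * real n))"
      using B0 assms(1) by (intro mult_left_mono) (auto simp: mult_le_cancel_left1)
    finally show ?thesis
      using False unfolding goal by (simp add: reflection_def)
  next
    case True
    let ?g = "\<lambda>w. gram K (of_real t) u w"
    have step: "cmod (?g w * ?M w) * t ^ changes (u # zs @ [y]) \<le> 2 * t ^ 2 * ?B" if w: "w \<in> {1..n}" for w
    proof -
      let ?d = "if u = w then 0 else 1 :: nat"
      \<comment> \<open>A diagonal Gram entry has order \<open>t^2\<close> and causes no change; an
        off-diagonal one has order \<open>t\<close> but comes with a change, worth another
        \<open>t\<close>.\<close>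
      have g: "cmod (?g w) * t ^ ?d \<le> 2 * t ^ 2"
      proof (cases "u = w")
        case True
        have "1 \<le> t ^ 2" using assms(1) by simp
        moreover have "cmod (1 + (of_real t)\<^sup>2) \<le> 1 + t\<^sup>2"
          using norm_triangle_ineq[of 1 "(complex_of_real t)\<^sup>2"] by (simp add: norm_power)
        ultimately show ?thesis using True by (simp add: gram_def)
      next
        case False
        then show ?thesis
          using mult_right_mono[OF K, of "t * t" u w] assms(1)
          by (simp add: gram_def norm_mult power2_eq_square mult.assoc)
      qed
      have "changes (u # zs @ [y]) \<le> ?d + changes (w # zs @ [y])"
        by (rule changes_replace) simp
      then have "t ^ changes (u # zs @ [y]) \<le> t ^ ?d * t ^ changes (w # zs @ [y])"
        unfolding power_add[symmetric] using assms(1) by (intro power_increasing) auto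
      then have "cmod (?g w * ?M w) * t ^ changes (u # zs @ [y]) \<le>
          cmod (?g w * ?M w) * (t ^ ?d * t ^ changes (w # zs @ [y]))"
        by (intro mult_left_mono) auto
      moreover have "\<dots> = (cmod (?g w) * t ^ ?d) * (cmod (?M w) * t ^ changes (w # zs @ [y]))"
        by (simp add: norm_mult)
      moreover have "\<dots> \<le> 2 * t ^ 2 * ?B"
        using mult_mono[OF g IH[OF w]] assms(1) by simp
      ultimately show ?thesis by linarith
    qed
    have eq: "rep n K (of_real t) (pos_word (u # zs)) (basis_vec y) x = ?M u - (\<Sum>w\<in>{1..n}. ?g w * ?M w)"
      using True by (simp add: reflection_def root_form_def)
    have "cmod (?M u - (\<Sum>w\<in>{1..n}. ?g w * ?M w)) \<le> cmod (?M u) + (\<Sum>w\<in>{1..n}. cmod (?g w * ?M w))"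
      by (intro order_trans[OF norm_triangle_ineq4] add_left_mono norm_sum)
    then have "cmod (?M u - (\<Sum>w\<in>{1..n}. ?g w * ?M w)) * t ^ changes (u # zs @ [y]) \<le>
        cmod (?M u) * t ^ changes (u # zs @ [y]) + (\<Sum>w\<in>{1..n}. cmod (?g w * ?M w) * t ^ changes (u # zs @ [y]))"
      unfolding sum_distrib_right[symmetric] distrib_right[symmetric]
      using assms(1) by (intro mult_right_mono) auto
    also have "\<dots> \<le> t ^ 2 * ?B + (\<Sum>w\<in>{1..n}. 2 * t ^ 2 * ?B)"
    proof (intro add_mono sum_mono step)
      have "1 * ?B \<le> t ^ 2 * ?B" using assms(1) B0 by (intro mult_right_mono) auto
      then show "cmod (?M u) * t ^ changes (u # zs @ [y]) \<le> t ^ 2 * ?B" using IH[OF u] by linarith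
    qed auto
    also have "\<dots> = ?B * (t ^ 2 * (1 + 2 * real n))" by (simp add: algebra_simps)
    finally show ?thesis
      unfolding goal eq using True by simp
  qed
qed

text \<open>The diagonal entry at \<open>x\<close> closes the word up by \<open>x\<close> at both
  ends, so cyclic changes are what the bound for the trace counts.\<close>

lemma op_trace_pos_bound:
  fixes t :: real
  assumes "t \<ge> 1" "\<And>u v. \<bar>K u v\<bar> \<le> 2" "set zs \<subseteq> {1..n}" "\<And>x. k \<le> changes (x # zs @ [x])"
  shows "cmod (op_trace n (rep n K (of_real t) (pos_word zs))) * t ^ k \<le>
    real n * (1 + 2 * real n) ^ length zs * t ^ (2 * length zs)"
proof -
  let ?M = "\<lambda>x. cmod (rep n K (of_real t) (pos_word zs) (basis_vec x) x)"
  have "cmod (op_trace n (rep n K (of_real t) (pos_word zs))) * t ^ k \<le> (\<Sum>x\<in>{1..n}. ?M x) * t ^ k"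
    unfolding op_trace_def using assms(1) by (intro mult_right_mono norm_sum) auto
  also have "\<dots> = (\<Sum>x\<in>{1..n}. ?M x * t ^ k)" by (rule sum_distrib_right)
  also have "\<dots> \<le> (\<Sum>x\<in>{1..n}. (1 + 2 * real n) ^ length zs * t ^ (2 * length zs))"
  proof (rule sum_mono)
    fix x assume x: "x \<in> {1..n}"
    have "?M x * t ^ k \<le> ?M x * t ^ changes (x # zs @ [x])"
      using assms(1,4) by (intro mult_left_mono power_increasing) auto
    also have "\<dots> \<le> (1 + 2 * real n) ^ length zs * t ^ (2 * length zs)"
      using rep_pos_bound[OF assms(1,2,3) x] .
    finally show "?M x * t ^ k \<le> (1 + 2 * real n) ^ length zs * t ^ (2 * length zs)" .
  qed
  finally show ?thesis by simp
qed

section \<open>Traces of words with four syllables\<close>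

text \<open>At \<open>s = \<i>\<close> the Gram entries are purely imaginary and the diagonal ones
  vanish. Pairs of factors thus contribute with a minus sign, triples are lost in the real part, and
  the product of all four keeps a plus sign. The convention \<open>K u u = 0\<close> lets equal
  letters obey the same formula.\<close>

lemma Re_trace_unipotent:
  assumes sub: "{p, x, y, t} \<subseteq> {1..n}"
    and K: "\<And>u v. K u v = K v u" "\<And>u. K u u = 0"
  shows "Re (op_trace n (rep n K \<i> (pos_word (replicate e p @ replicate f x @ replicate g y @ replicate h t)))) =
    real n + real e * f * g * h * K p x * K x y * K y t * K t p
    - (real e * f * (K p x)\<^sup>2 + real f * g * (K x y)\<^sup>2 + real g * h * (K y t)\<^sup>2 + real h * e * (K t p)\<^sup>2
      + real e * g * (K p y)\<^sup>2 + real f * h * (K x t)\<^sup>2)"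
proof -
  have gram: "gram K \<i> u v = of_real (- K u v) * \<i>" for u v
    by (simp add: gram_def K(2))
  have "op_trace n (rep n K \<i> (pos_word (replicate e p @ replicate f x @ replicate g y @ replicate h t))) =
    op_trace n (\<lambda>v. reflection n K \<i> (of_real e) p (reflection n K \<i> (of_real f) x
      (reflection n K \<i> (of_real g) y (reflection n K \<i> (of_real h) t v))))"
    using sub by (simp add: op_trace_def rep_replicate del: replicate.simps)
  also have "Re \<dots> = real n + real e * f * g * h * K p x * K x y * K y t * K t p
    - (real e * f * (K p x)\<^sup>2 + real f * g * (K x y)\<^sup>2 + real g * h * (K y t)\<^sup>2 + real h * e * (K t p)\<^sup>2
      + real e * g * (K p y)\<^sup>2 + real f * h * (K x t)\<^sup>2)"
    unfolding op_trace_reflection4[OF sub] gram K(2)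
    by (simp add: K(1)[of x p] K(1)[of y x] K(1)[of t y] K(1)[of p t] K(1)[of y p] K(1)[of t x]
        power2_eq_square algebra_simps)
  finally show ?thesis .
qed

text \<open>Let \<open>U^2\<close> be the first product in the equation and
  \<open>V = i^2 * \<kappa>^2\<close>. The inequality of means bounds the four adjacent terms below
  by \<open>4 * U\<close>, so \<open>V^2 - 4 * V \<le> U^2 - 4 * U\<close>, which forces
  \<open>U \<ge> V\<close>. Bounding the exponents by their mean and the \<open>k1\<close> to
  \<open>k4\<close> by \<open>\<kappa>\<close> gives the converse, so equality holds
  throughout.\<close>

lemma four_exponents_rigid:
  fixes e f g h i \<kappa> k1 k2 k3 k4 k5 k6 :: real
  assumes nn: "e \<ge> 0" "f \<ge> 0" "g \<ge> 0" "h \<ge> 0" and sum: "e + f + g + h = 4 * i"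
    and k: "k1 \<ge> 0" "k2 \<ge> 0" "k3 \<ge> 0" "k4 \<ge> 0" "k1 \<le> \<kappa>" "k2 \<le> \<kappa>" "k3 \<le> \<kappa>" "k4 \<le> \<kappa>"
    and "\<kappa> \<ge> 1" "i \<ge> 3"
    and eq: "e * f * g * h * k1 * k2 * k3 * k4
      - (e * f * k1\<^sup>2 + f * g * k2\<^sup>2 + g * h * k3\<^sup>2 + h * e * k4\<^sup>2 + e * g * k5\<^sup>2 + f * h * k6\<^sup>2) =
      i ^ 4 * \<kappa> ^ 4 - 4 * i\<^sup>2 * \<kappa>\<^sup>2"
  shows "e = i" "f = i" "g = i" "h = i" "k5 = 0" "k6 = 0" "k1 \<noteq> 0"
proof -
  define P where "P = e * f * g * h"
  define k where "k = k1 * k2 * k3 * k4"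
  define U where "U = sqrt (P * k)"
  define V where "V = i\<^sup>2 * \<kappa>\<^sup>2"
  let ?D = "e * g * k5\<^sup>2 + f * h * k6\<^sup>2"
  have P0: "P \<ge> 0" and k0: "k \<ge> 0" using assms by (simp_all add: P_def k_def)
  have U0: "U \<ge> 0" and U2: "U\<^sup>2 = P * k" using P0 k0 by (simp_all add: U_def)
  have sq: "2 * (a * b) \<le> a\<^sup>2 + b\<^sup>2" for a b :: real
    using zero_le_power2[of "a - b"] by (simp add: power2_diff)
  have "4 * U \<le> e * f * k1\<^sup>2 + f * g * k2\<^sup>2 + g * h * k3\<^sup>2 + h * e * k4\<^sup>2"
  proof -
    \<comment> \<open>Opposite edges of the four-cycle are paired, since then each pair involves all
      four exponents; the third inequality combines the two pairs.\<close>
    have "2 * (sqrt P * (k1 * k3)) \<le> e * f * k1\<^sup>2 + g * h * k3\<^sup>2"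
      using sq[of "sqrt (e * f) * k1" "sqrt (g * h) * k3"] nn
      by (simp add: power_mult_distrib P_def real_sqrt_mult algebra_simps)
    moreover have "2 * (sqrt P * (k2 * k4)) \<le> f * g * k2\<^sup>2 + h * e * k4\<^sup>2"
      using sq[of "sqrt (f * g) * k2" "sqrt (h * e) * k4"] nn
      by (simp add: power_mult_distrib P_def real_sqrt_mult algebra_simps)
    moreover have "2 * (sqrt P * sqrt k) \<le> sqrt P * (k1 * k3) + sqrt P * (k2 * k4)"
    proof -
      have "2 * sqrt k \<le> k1 * k3 + k2 * k4"
        using sq[of "sqrt (k1 * k3)" "sqrt (k2 * k4)"] assms(6-9)
        by (simp add: k_def real_sqrt_mult algebra_simps)
      then have "sqrt P * (2 * sqrt k) \<le> sqrt P * (k1 * k3 + k2 * k4)"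
        using P0 by (intro mult_left_mono) auto
      then show ?thesis by (simp add: algebra_simps)
    qed
    moreover have "U = sqrt P * sqrt k" by (simp add: U_def real_sqrt_mult)
    ultimately show ?thesis by linarith
  qed
  moreover have D0: "?D \<ge> 0" using nn by simp
  moreover have eq': "U\<^sup>2 - (e * f * k1\<^sup>2 + f * g * k2\<^sup>2 + g * h * k3\<^sup>2 + h * e * k4\<^sup>2) - ?D = V\<^sup>2 - 4 * V"
  proof -
    have "V\<^sup>2 = i ^ 4 * \<kappa> ^ 4" by (simp add: V_def power_mult_distrib)
    then show ?thesis using eq unfolding U2 V_def P_def k_def by (simp add: algebra_simps)
  qed
  ultimately have UV: "V\<^sup>2 - 4 * V \<le> U\<^sup>2 - 4 * U - ?D" by linarith
  have V9: "V \<ge> 9"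
  proof -
    have "3\<^sup>2 * 1\<^sup>2 \<le> i\<^sup>2 * \<kappa>\<^sup>2" using assms(14,15) by (intro mult_mono power_mono) auto
    then show ?thesis by (simp add: V_def)
  qed
  have "U \<ge> V"
  proof (rule ccontr)
    assume "\<not> U \<ge> V"
    \<comment> \<open>As \<open>V\<close> exceeds 4, the second factor is positive for every
      \<open>U \<ge> 0\<close>, even where \<open>U^2 - 4 * U\<close> is not increasing.\<close>
    then have "(V - U) * (V + U - 4) > 0" using V9 U0 by (intro mult_pos_pos) auto
    then show False using UV D0 by (simp add: power2_eq_square algebra_simps)
  qed
  have AM: "4 * (a * b) \<le> (a + b)\<^sup>2" for a b :: real
    using zero_le_power2[of "a - b"] by (simp add: power2_eq_square algebra_simps)
  have ef: "4 * (e * f) \<le> (e + f)\<^sup>2" and gh: "4 * (g * h) \<le> (g + h)\<^sup>2" by (rule AM)+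
  have efgh: "(e + f) * (g + h) \<le> 4 * i\<^sup>2"
  proof -
    have "4 * ((e + f) * (g + h)) \<le> (4 * i)\<^sup>2" using AM[of "e + f" "g + h"] sum by (simp add: algebra_simps)
    then show ?thesis by (simp add: power2_eq_square)
  qed
  have P_le': "16 * P \<le> ((e + f) * (g + h))\<^sup>2"
    using mult_mono[OF ef gh] nn unfolding power_mult_distrib by (simp add: P_def mult.assoc mult.left_commute)
  have "((e + f) * (g + h))\<^sup>2 \<le> (4 * i\<^sup>2)\<^sup>2"
    using efgh nn by (intro power_mono) auto
  then have P_le: "P \<le> i ^ 4" using P_le' by (simp add: power_mult_distrib)
  have k_le: "k \<le> \<kappa> ^ 4"
  proof -
    have "k1 * k2 * k3 * k4 \<le> \<kappa> * \<kappa> * \<kappa> * \<kappa>"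
      using assms(6-14) by (intro mult_mono mult_nonneg_nonneg) auto
    then show ?thesis by (simp add: k_def power4_eq_xxxx)
  qed
  have V2: "V\<^sup>2 = i ^ 4 * \<kappa> ^ 4" by (simp add: V_def power_mult_distrib)
  have "V\<^sup>2 \<le> U\<^sup>2" using \<open>U \<ge> V\<close> V9 by (intro power_mono) auto
  then have ge: "i ^ 4 * \<kappa> ^ 4 \<le> P * k" using V2 U2 by simp
  have \<kappa>4: "\<kappa> ^ 4 > 0" using assms(14) by simp
  have "i ^ 4 * \<kappa> ^ 4 > 0" using assms(14,15) by simp
  then show "k1 \<noteq> 0" using ge by (auto simp: k_def)
  have "P * k \<le> P * \<kappa> ^ 4" using P0 k_le by (rule mult_left_mono[rotated])
  with ge have "i ^ 4 * \<kappa> ^ 4 \<le> P * \<kappa> ^ 4" by linarith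
  then have P: "P = i ^ 4" using P_le \<kappa>4 by simp
  have "P * k \<le> i ^ 4 * \<kappa> ^ 4" using P_le k_le k0 P0 by (intro mult_mono) auto
  then have "U\<^sup>2 = V\<^sup>2" using ge V2 U2 by simp
  then have "U = V" using U0 V9 by (simp add: power2_eq_iff)
  then have "?D \<le> 0" using UV by simp
  \<comment> \<open>The equality \<open>P = i ^ 4\<close> is traced back through the inequalities of
    means: first \<open>e + f = g + h\<close>, then \<open>e = f\<close> and
    \<open>g = h\<close>.\<close>
  have "(4 * i\<^sup>2)\<^sup>2 \<le> ((e + f) * (g + h))\<^sup>2"
    using P_le' P by (simp add: power_mult_distrib)
  then have "4 * i\<^sup>2 \<le> (e + f) * (g + h)"
    using nn by (meson power2_le_imp_le mult_nonneg_nonneg add_nonneg_nonneg)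
  then have "((e + f) - (g + h))\<^sup>2 \<le> (e + f + g + h)\<^sup>2 - (4 * i)\<^sup>2"
    by (simp add: power2_eq_square algebra_simps)
  then have "((e + f) - (g + h))\<^sup>2 \<le> 0" using sum by simp
  then have "e + f = g + h" by simp
  then have s1: "e + f = 2 * i" and s2: "g + h = 2 * i" using sum by auto
  have ef: "e * f \<le> i\<^sup>2" using ef s1 by (simp add: power_mult_distrib)
  have gh: "g * h \<le> i\<^sup>2" using gh s2 by (simp add: power_mult_distrib)
  have Pi: "(e * f) * (g * h) = i\<^sup>2 * i\<^sup>2" using P by (simp add: P_def power4_eq_xxxx power2_eq_square mult.assoc)
  have i2: "i\<^sup>2 > 0" using assms(15) by simp
  have "(e * f) * (g * h) \<le> (e * f) * i\<^sup>2" using gh nn by (intro mult_left_mono) auto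
  then have "i\<^sup>2 * i\<^sup>2 \<le> (e * f) * i\<^sup>2" unfolding Pi .
  then have ef': "e * f = i\<^sup>2" using ef mult_right_le_imp_le[OF _ i2] by (intro antisym)
  have gh': "g * h = i\<^sup>2" using Pi i2 unfolding ef' by (metis less_irrefl mult_cancel_left)
  have "(e - f)\<^sup>2 = (e + f)\<^sup>2 - 4 * (e * f)" by (simp add: power2_eq_square algebra_simps)
  then have "e = f" using s1 ef' by (simp add: power_mult_distrib)
  then show ei: "e = i" and fi: "f = i" using s1 by simp_all
  have "(g - h)\<^sup>2 = (g + h)\<^sup>2 - 4 * (g * h)" by (simp add: power2_eq_square algebra_simps)
  then have "g = h" using s2 gh' by (simp add: power_mult_distrib)
  then show gi: "g = i" and hi: "h = i" using s2 by simp_all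
  have "i\<^sup>2 * (k5\<^sup>2 + k6\<^sup>2) \<le> 0"
    using \<open>?D \<le> 0\<close> by (simp add: ei fi gi hi power2_eq_square algebra_simps)
  then have "k5\<^sup>2 + k6\<^sup>2 \<le> 0" using i2 by (simp add: mult_le_0_iff)
  then show "k5 = 0" "k6 = 0" by (simp_all add: sum_power2_le_zero_iff)
qed

section \<open>Growth of the trace of a square word and its consequence for changes\<close>

definition square_word :: "nat \<Rightarrow> 'a \<Rightarrow> 'a \<Rightarrow> 'a list" where
  "square_word i x y = replicate i x @ replicate i y @ replicate i x @ replicate i y"

text \<open>For even \<open>i\<close> the trace is a sum of nonnegative terms, so nothing cancels.
  The term \<open>Y^2\<close> alone already has order \<open>t ^ (8 * i - 4)\<close>, matching four
  cyclic changes.\<close>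

lemma trace_square_word_ge:
  fixes t :: real
  assumes xy: "x \<in> {1..n}" "y \<in> {1..n}" "x \<noteq> y" and K: "K x y = K y x" "K x y \<ge> 1"
    and "t \<ge> 2" "even i" "i \<ge> 1"
  shows "t ^ (8 * i) \<le> 256 * t ^ 4 * cmod (op_trace n (rep n K (of_real t) (pos_word (square_word i x y))))"
proof -
  define q where "q = t\<^sup>2"
  define c where "c = (\<Sum>k<i. (- q) ^ k)"
  define X where "X = c * (1 + q)"
  define Y where "Y = c\<^sup>2 * (K x y)\<^sup>2 * q"
  have c: "(\<Sum>k<i. (- (complex_of_real t)\<^sup>2) ^ k) = of_real c"
    by (simp add: c_def q_def)
  have "2 \<le> card {1..n}" using card_mono[of "{1..n}" "{x, y}"] xy by simp
  then have n: "n \<ge> 2" by simp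
  have q4: "q \<ge> 4" using power_mono[of 2 t 2] assms(6) by (simp add: q_def)
  have "(1 - - q) * c = 1 - (- q) ^ i"
    unfolding c_def using one_diff_power_eq[of "- q" i] by simp
  \<comment> \<open>Evenness of \<open>i\<close> fixes the sign of \<open>(- q) ^ i\<close>, so
    \<open>X\<close> is negative and the mixed term \<open>- 4 * X * Y\<close> becomes
    helpful.\<close>
  then have X: "X = 1 - q ^ i" using assms(7) by (simp add: X_def mult.commute)
  have "op_trace n (rep n K (of_real t) (pos_word (square_word i x y))) =
      op_trace n (\<lambda>v. reflection n K (of_real t) (of_real c) x (reflection n K (of_real t) (of_real c) y
      (reflection n K (of_real t) (of_real c) x (reflection n K (of_real t) (of_real c) y v))))"
    using xy by (simp add: square_word_def op_trace_def rep_replicate c del: replicate.simps)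
  also have "\<dots> = of_real (real n - 4 * X + 2 * X\<^sup>2 + 4 * Y - 4 * X * Y + Y\<^sup>2)"
  proof -
    have g: "gram K (of_real t) x x = of_real (1 + q)" "gram K (of_real t) y y = of_real (1 + q)"
      "gram K (of_real t) x y = of_real (- K x y * t)" "gram K (of_real t) y x = of_real (- K x y * t)"
      using xy K by (simp_all add: gram_def q_def)
    have sub: "{x, y, x, y} \<subseteq> {1..n}" using xy by simp
    show ?thesis
      unfolding op_trace_reflection4[OF sub] g
      by (simp add: X_def Y_def q_def power2_eq_square algebra_simps)
  qed
  also have "real n - 4 * X + 2 * X\<^sup>2 + 4 * Y - 4 * X * Y + Y\<^sup>2 =
      Y\<^sup>2 + 4 * Y * q ^ i + 2 * (q ^ i)\<^sup>2 + (real n - 2)"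
    unfolding X by (simp add: power2_eq_square algebra_simps)
  finally have tr: "op_trace n (rep n K (of_real t) (pos_word (square_word i x y))) = of_real \<dots>" .
  have Y0: "Y \<ge> 0" using q4 by (simp add: Y_def)
  then have "Y\<^sup>2 \<le> Y\<^sup>2 + 4 * Y * q ^ i + 2 * (q ^ i)\<^sup>2 + (real n - 2)"
    using n q4 by simp
  then have tr_ge: "Y\<^sup>2 \<le> cmod (op_trace n (rep n K (of_real t) (pos_word (square_word i x y))))"
    unfolding tr norm_of_real by linarith
  have "q ^ i \<ge> q ^ 1" using q4 assms(8) by (intro power_increasing) auto
  then have "q ^ i \<le> 2 * (q ^ i - 1)" using q4 by simp
  also have "\<dots> = 2 * (1 + q) * - c" using X by (simp add: X_def algebra_simps)
  finally have *: "q ^ i \<le> 2 * (1 + q) * - c" .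
  then have "0 < 2 * (1 + q) * - c" using q4 by (smt (verit) zero_less_power)
  then have "- c > 0" using q4 by (intro zero_less_mult_pos[of "2 * (1 + q)" "- c"]) auto
  then have "2 * (1 + q) * - c \<le> 4 * q * - c" using q4 by (intro mult_right_mono) auto
  \<comment> \<open>The factor 4 comes from \<open>q ^ i \<le> 2 * (q ^ i - 1)\<close> and
    \<open>1 + q \<le> 2 * q\<close>; squaring it twice yields the constant 256.\<close>
  then have "(q ^ i)\<^sup>2 \<le> (4 * q * - c)\<^sup>2" using * q4 by (intro power_mono) auto
  also have "\<dots> = 16 * q * (c\<^sup>2 * 1 * q)" by (simp add: power2_eq_square)
  also have "\<dots> \<le> 16 * q * Y"
    unfolding Y_def using q4 K(2) by (intro mult_left_mono mult_right_mono) auto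
  finally have "((q ^ i)\<^sup>2)\<^sup>2 \<le> (16 * q * Y)\<^sup>2" by (intro power_mono) auto
  also have "\<dots> = 256 * q\<^sup>2 * Y\<^sup>2" by (simp add: power_mult_distrib)
  also have "\<dots> \<le> 256 * q\<^sup>2 * cmod (op_trace n (rep n K (of_real t) (pos_word (square_word i x y))))"
    using tr_ge by (intro mult_left_mono) auto
  also have "q\<^sup>2 = t ^ 4" by (simp add: q_def power_mult[symmetric])
  also have "((q ^ i)\<^sup>2)\<^sup>2 = t ^ (8 * i)" by (simp add: q_def power_mult[symmetric] mult.commute)
  finally show ?thesis .
qed

text \<open>With five changes in every closed-up word, the trace of \<open>z\<close> would be at
  most a constant times \<open>t ^ (8 * i - 5)\<close>, against a lower bound of order
  \<open>t ^ (8 * i - 4)\<close>.\<close>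

lemma few_changes:
  assumes xy: "x \<in> {1..n}" "y \<in> {1..n}" "x \<noteq> y" and K: "K x y = K y x" "K x y \<ge> 1" "\<And>u v. \<bar>K u v\<bar> \<le> 2"
    and "even i" "i \<ge> 1" and z: "set z \<subseteq> {1..n}" "length z = 4 * i"
    and tr: "\<And>s. s \<noteq> 0 \<Longrightarrow> op_trace n (rep n K s (pos_word z)) = op_trace n (rep n K s (pos_word (square_word i x y)))"
  shows "\<exists>u. changes (u # z @ [u]) \<le> 4"
proof (rule ccontr)
  assume "\<not> ?thesis"
  then have 5: "5 \<le> changes (u # z @ [u])" for u by (simp add: not_le) (metis Suc_leI eval_nat_numeral(3))
  define A where "A = real n * (1 + 2 * real n) ^ (4 * i)"
  \<comment> \<open>Any \<open>t > 256 * A\<close> with \<open>t \<ge> 2\<close> contradicts the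
    comparison of the two bounds.\<close>
  define t where "t = 2 + 256 * A"
  have A0: "A \<ge> 0" by (simp add: A_def)
  then have t: "t \<ge> 2" by (simp add: t_def)
  let ?T = "cmod (op_trace n (rep n K (of_real t) (pos_word z)))"
  have "?T * t ^ 5 \<le> A * t ^ (8 * i)"
    using op_trace_pos_bound[of t K z n 5] t K(3) z 5 by (simp add: A_def)
  moreover have "t ^ (8 * i) \<le> 256 * t ^ 4 * ?T"
    using trace_square_word_ge[OF xy K(1,2) t assms(7,8)] tr[of "of_real t"] t by simp
  then have "t * t ^ (8 * i) \<le> t * (256 * t ^ 4 * ?T)" using t by (intro mult_left_mono) auto
  moreover have "t * (256 * t ^ 4 * ?T) = 256 * (?T * t ^ 5)" by (simp add: eval_nat_numeral)
  ultimately have "t * t ^ (8 * i) \<le> (256 * A) * t ^ (8 * i)" by linarith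
  then have "t \<le> 256 * A" using t by (simp add: mult_le_cancel_right)
  then show False by (simp add: t_def)
qed

section \<open>Runs of equal letters and shortlex least words\<close>

lemma changes_snoc: "zs \<noteq> [] \<Longrightarrow> changes (zs @ [y]) = changes zs + (if last zs = y then 0 else 1)"
  by (induction zs rule: changes.induct) auto

text \<open>The letter \<open>u\<close> cannot equal both ends of \<open>zs\<close>, so closing up
  costs at least one more change.\<close>

lemma changes_close:
  assumes "zs \<noteq> []" "hd zs \<noteq> last zs" "changes (u # zs @ [u]) \<le> Suc k"
  shows "changes zs \<le> k"
proof -
  have "changes (u # zs @ [u]) = (if u = hd zs then 0 else 1) + changes (zs @ [u])"
    using assms(1) by (cases zs) auto
  then show ?thesis
    using assms changes_snoc[OF assms(1), of u] by (auto split: if_splits)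
qed

definition runs :: "'a list \<Rightarrow> nat" where
  "runs zs = (if zs = [] then 0 else Suc (changes zs))"

lemma runs_Cons: "runs (x # zs) = (if zs \<noteq> [] \<and> hd zs = x then runs zs else Suc (runs zs))"
  by (cases zs) (auto simp: runs_def)

lemma split_first_run:
  assumes "set zs \<subseteq> A" "q \<in> A"
  shows "\<exists>e p ys. p \<in> A \<and> set ys \<subseteq> A \<and> zs = replicate e p @ ys \<and> runs ys = runs zs - 1 \<and>
    (zs \<noteq> [] \<longrightarrow> e > 0) \<and> (ys \<noteq> [] \<longrightarrow> hd ys \<noteq> p)"
  using assms(1)
proof (induction zs)
  case Nil
  \<comment> \<open>The empty word gets exponent 0 and the default letter \<open>q\<close>;
    truncated subtraction keeps its number of runs at 0.\<close>
  then show ?case using assms(2) by (intro exI[of _ 0] exI[of _ q] exI[of _ "[]"]) (simp add: runs_def)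
next
  case (Cons x zs)
  then obtain e p ys where *: "p \<in> A" "set ys \<subseteq> A" "zs = replicate e p @ ys" "runs ys = runs zs - 1"
    "zs \<noteq> [] \<longrightarrow> e > 0" "ys \<noteq> [] \<longrightarrow> hd ys \<noteq> p"
    by auto
  show ?case
  proof (cases "zs \<noteq> [] \<and> hd zs = x")
    case True
    then have "p = x" using * by (cases e) auto
    then show ?thesis
      using * True by (intro exI[of _ "Suc e"] exI[of _ p] exI[of _ ys]) (simp add: runs_Cons)
  next
    case False
    then show ?thesis
      using Cons.prems by (intro exI[of _ 1] exI[of _ x] exI[of _ zs]) (auto simp: runs_Cons)
  qed
qed

text \<open>Shorter words are padded by syllables of exponent 0, so one trace formula covers all
  cases.\<close>

lemma split_four_runs:
  assumes "set zs \<subseteq> A" "q \<in> A" "runs zs \<le> 4"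
  shows "\<exists>e p f x g y h t. {p, x, y, t} \<subseteq> A \<and>
    zs = replicate e p @ replicate f x @ replicate g y @ replicate h t"
proof -
  obtain e p ys1 where 1: "p \<in> A" "set ys1 \<subseteq> A" "zs = replicate e p @ ys1" "runs ys1 = runs zs - 1"
    using split_first_run[OF assms(1,2)] by blast
  obtain f x ys2 where 2: "x \<in> A" "set ys2 \<subseteq> A" "ys1 = replicate f x @ ys2" "runs ys2 = runs ys1 - 1"
    using split_first_run[OF 1(2) assms(2)] by blast
  obtain g y ys3 where 3: "y \<in> A" "set ys3 \<subseteq> A" "ys2 = replicate g y @ ys3" "runs ys3 = runs ys2 - 1"
    using split_first_run[OF 2(2) assms(2)] by blast
  obtain h t ys4 where 4: "t \<in> A" "set ys4 \<subseteq> A" "ys3 = replicate h t @ ys4" "runs ys4 = runs ys3 - 1"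
    using split_first_run[OF 3(2) assms(2)] by blast
  have "runs ys4 = 0" using 1 2 3 4 assms(3) by linarith
  then have "ys4 = []" by (simp add: runs_def split: if_splits)
  then have "{p, x, y, t} \<subseteq> A \<and> zs = replicate e p @ replicate f x @ replicate g y @ replicate h t"
    using 1 2 3 4 by simp
  then show ?thesis by blast
qed

section \<open>Existence of shortlex least words\<close>

lemma shortlex_total_on_lists:
  assumes "linear_order_on A r" "xs \<in> lists A" "ys \<in> lists A"
  shows "(xs, ys) \<in> shortlex r \<or> (ys, xs) \<in> lenlex (r - Id)"
  using assms(2,3)
proof (induction xs arbitrary: ys rule: list.induct)
  case Nil
  then show ?case by (auto simp: shortlex_def)
next
  case (Cons x xs)
  show ?case
  proof (cases ys)
    case ys: (Cons y ys')
    have "x = y \<or> (x, y) \<in> r - Id \<or> (y, x) \<in> r - Id"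
      using assms(1) Cons.prems ys unfolding linear_order_on_def total_on_def by auto
    then show ?thesis
      using Cons.IH[of ys'] Cons.prems ys
      by (auto simp: shortlex_def Cons_lenlex_iff dest: lenlex_length)
  qed simp
qed

text \<open>On a finite alphabet the strict order is well-founded, hence so is its
  length-lexicographic extension; a minimal word is least by totality.\<close>

lemma ex_shortlex_least:
  assumes "linear_order_on A r" "finite A" "L \<subseteq> lists A" "w \<in> L"
  shows "\<exists>z. shortlex_least r L z"
proof -
  have "finite (r - Id)"
    using assms(1,2) finite_subset[of r "A \<times> A"]
    by (auto simp: linear_order_on_def partial_order_on_def preorder_on_def)
  moreover have "acyclic (r - Id)"
    using assms(1) partial_order_on_acyclic by (auto simp: linear_order_on_def)
  ultimately have "wf (lenlex (r - Id))" by (intro wf_lenlex finite_acyclic_wf)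
  then obtain z where "z \<in> L" "\<And>y. (y, z) \<in> lenlex (r - Id) \<Longrightarrow> y \<notin> L"
    using wfE_min[OF _ assms(4)] by metis
  then show ?thesis
    using shortlex_total_on_lists[OF assms(1)] assms(3) unfolding shortlex_least_def by blast
qed

section \<open>Artin groups of large type\<close>

text \<open>No relation constrains the value for \<open>m u v = \<infinity>\<close>; any constant in \<open>[1, 2]\<close> would do.\<close>

definition cox_cos :: "nat \<Rightarrow> (nat \<Rightarrow> nat \<Rightarrow> enat) \<Rightarrow> nat \<Rightarrow> nat \<Rightarrow> real" where
  "cox_cos n m u v = (if u \<in> {1..n} \<and> v \<in> {1..n} \<and> u \<noteq> v
    then case m u v of enat k \<Rightarrow> 2 * cos (pi / k) | \<infinity> \<Rightarrow> 2 else 0)"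

lemma abs_cox_cos_le: "\<bar>cox_cos n m u v\<bar> \<le> 2"
  by (auto simp: cox_cos_def abs_mult split: enat.split)

locale large_artin = presentation "{1..n}" "artin_relations n m"
  for n :: nat and m :: "nat \<Rightarrow> nat \<Rightarrow> enat" +
  assumes n2: "n \<ge> 2" and cox: "coxeter_matrix n m" and large: "large_type n m"
begin

abbreviation K where "K \<equiv> cox_cos n m"

lemma K_sym: "K u v = K v u"
  using cox by (auto simp: cox_cos_def coxeter_matrix_def)

lemma K_diag: "K u u = 0"
  by (simp add: cox_cos_def)

lemma order_ge_3: "i \<in> {1..n} \<Longrightarrow> j \<in> {1..n} \<Longrightarrow> i \<noteq> j \<Longrightarrow> m i j = enat k \<Longrightarrow> k \<ge> 3"
  using large unfolding large_type_def by (metis enat_ord_simps(1) numeral_eq_enat)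

text \<open>Large type gives \<open>pi / k \<le> pi / 3\<close>. It follows that \<open>K\<close>
  vanishes on pairs of generators only when they are equal.\<close>

lemma K_ge_1:
  assumes "u \<in> {1..n}" "v \<in> {1..n}" "u \<noteq> v"
  shows "K u v \<ge> 1"
proof (cases "m u v")
  case (enat k)
  then have k: "real k \<ge> 3" using order_ge_3[OF assms] by simp
  then have "pi / k \<le> pi / 3" by (intro divide_left_mono) auto
  then have "cos (pi / 3) \<le> cos (pi / k)" by (intro cos_monotone_0_pi_le) auto
  then show ?thesis using enat assms by (simp add: cox_cos_def cos_60)
qed (use assms in \<open>simp add: cox_cos_def\<close>)

lemma K_nonneg: "K u v \<ge> 0"
proof (cases "u \<in> {1..n} \<and> v \<in> {1..n} \<and> u \<noteq> v")
  case True
  then show ?thesis using K_ge_1[of u v] by simp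
qed (auto simp: cox_cos_def)

text \<open>For the angle \<open>pi / k\<close> with \<open>k \<ge> 3\<close>, the sine of the angle
  is nonzero while the sine of its \<open>k\<close>-fold multiple vanishes, so
  \<open>rep_braid\<close> covers every relation.\<close>

lemma rep_eqv:
  assumes "pres_eq {1..n} (artin_relations n m) u v" "s \<noteq> 0"
  shows "rep n K s u = rep n K s v"
proof (rule ext, rule rep_cong[OF assms])
  fix x y a assume "(x, y) \<in> artin_relations n m"
  then obtain i j k where ij: "i \<in> {1..n}" "j \<in> {1..n}" "i \<noteq> j" "m i j = enat k"
    and xy: "x = alternating k (i, True) (j, True)" "y = alternating k (j, True) (i, True)"
    unfolding artin_relations_def by blast
  have k: "k \<ge> 3" using order_ge_3 ij by blast
  have "K i j = 2 * cos (pi / k)" using ij by (simp add: cox_cos_def)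
  moreover have "0 < pi / real k" "pi / real k < pi" using k by (simp_all add: field_simps)
  then have "sin (pi / k) \<noteq> 0" using sin_gt_zero[of "pi / real k"] by simp
  moreover have "sin (real k * (pi / k)) = 0" using k by simp
  ultimately show "rep n K s x a = rep n K s y a"
    unfolding xy using rep_braid[of i j n K "pi / k" s k a] ij assms(2) K_sym[of j i] by simp
qed

lemma op_trace_conj:
  assumes "conj_words u v" "u \<in> words" "s \<noteq> 0"
  shows "op_trace n (rep n K s u) = op_trace n (rep n K s v)"
proof -
  obtain g where g: "g \<in> words" "pres_eq {1..n} (artin_relations n m) (g @ u @ inv_word g) v"
    using assms(1) unfolding conj_words_def by blast
  have "op_trace n (rep n K s v) = op_trace n (rep n K s (g @ (u @ inv_word g)))"
    using rep_eqv[OF g(2) assms(3)] by simp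
  also have "\<dots> = op_trace n (rep n K s ((u @ inv_word g) @ g))"
    using g(1) assms(2) inv_word_words by (intro op_trace_rep_commute) auto
  also have "rep n K s ((u @ inv_word g) @ g) = rep n K s u"
  proof
    fix a
    have "rep n K s (inv_word g) (rep n K s g a) = a"
      using fun_cong[OF rep_eqv[OF inv_word_left[OF R_words g(1)] assms(3)], of a] by simp
    then show "rep n K s ((u @ inv_word g) @ g) a = rep n K s u a" by simp
  qed
  finally show ?thesis by simp
qed

lemma exponent_sum_conj:
  assumes "conj_words u v"
  shows "exponent_sum u = exponent_sum v"
proof -
  obtain g where g: "pres_eq {1..n} (artin_relations n m) (g @ u @ inv_word g) v"
    using assms unfolding conj_words_def by blast
  have "exponent_sum (g @ u @ inv_word g) = exponent_sum v"
    by (rule exponent_sum_cong[OF g]) (auto simp: artin_relations_def exponent_sum_alternating)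
  then show ?thesis by simp
qed

lemma ConjSL_iff: "z \<in> ConjSL n m r \<longleftrightarrow> shortlex_least r {w \<in> words. conj_words z w} z"
  unfolding ConjSL_def artin_group_def artin_elem_def mem_Collect_eq shortlex_least_class_iff ..

lemma ex_max_K: "\<exists>x\<in>{1..n}. \<exists>y\<in>{1..n}. x \<noteq> y \<and> (\<forall>u v. K u v \<le> K x y)"
proof -
  let ?P = "{(u, v). u \<in> {1..n} \<and> v \<in> {1..n} \<and> u \<noteq> v}"
  have "?P \<subseteq> {1..n} \<times> {1..n}" by auto
  then have "finite ?P" by (rule finite_subset) simp
  moreover have "(1, 2) \<in> ?P" using n2 by simp
  ultimately have *: "finite ((\<lambda>(u, v). K u v) ` ?P)" "(\<lambda>(u, v). K u v) ` ?P \<noteq> {}" by blast+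
  obtain x y where xy: "(x, y) \<in> ?P" "Max ((\<lambda>(u, v). K u v) ` ?P) = K x y"
    using Max_in[OF *] by auto
  have "K u v \<le> K x y" for u v
  proof (cases "(u, v) \<in> ?P")
    case True
    then have "K u v \<in> (\<lambda>(u, v). K u v) ` ?P" by (intro image_eqI[of _ _ "(u, v)"]) auto
    from Max_ge[OF *(1) this] show ?thesis unfolding xy(2) .
  next
    case False
    then have "K u v = 0" by (auto simp: cox_cos_def)
    then show ?thesis using K_nonneg by simp
  qed
  then show ?thesis using xy(1) by blast
qed

section \<open>Shape of the shortlex least words\<close>

context
  fixes r :: "(nat letter \<times> nat letter) set"
  assumes lin: "linear_order_on (letters {1..n}) r"
begin

lemma irrefl_strict: "irrefl (r - Id)"
  by (simp add: irrefl_def)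

lemma strict_antisym: "(a, b) \<in> r - Id \<Longrightarrow> (b, a) \<notin> r - Id"
  using lin antisymD[of r a b] by (auto simp: linear_order_on_def partial_order_on_def)

lemma ConjSL_rotate:
  assumes "u @ v \<in> ConjSL n m r"
  shows "(u @ v, v @ u) \<in> shortlex r"
proof -
  have uv: "u \<in> words" "v \<in> words"
    using assms unfolding ConjSL_iff shortlex_least_def by auto
  then have "v @ u \<in> {w \<in> words. conj_words (u @ v) w}"
    using conj_words_rotate by simp
  then show ?thesis
    using assms unfolding ConjSL_iff shortlex_least_def by blast
qed

lemma shortlex_Cons_same_length:
  assumes "(a # u, b # v) \<in> shortlex r" "length u = length v" "a \<noteq> b"
  shows "(a, b) \<in> r - Id"
  using assms by (auto simp: shortlex_def Cons_lenlex_iff)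

lemma shortlex_append_Cons:
  assumes "(w @ a # u, w @ b # v) \<in> shortlex r" "length u = length v" "a \<noteq> b"
  shows "(a, b) \<in> r - Id"
  using assms by (auto simp: shortlex_def lenlex_append2[OF irrefl_strict] Cons_lenlex_iff)

text \<open>Suppose \<open>z\<close> starts and ends with \<open>p\<close>, and \<open>x\<close>
  follows the first run. Moving that run to the end gives a word starting with \<open>x\<close>, so
  \<open>p\<close> precedes \<open>x\<close>. Moving the last letter to the front lengthens the
  first run, putting \<open>p\<close> where \<open>x\<close> stood, so \<open>x\<close> precedes
  \<open>p\<close>.\<close>

lemma ConjSL_last:
  assumes "z \<in> ConjSL n m r" "runs z \<ge> 2"
  shows "last z \<noteq> hd z"
proof
  assume last: "last z = hd z"
  have "z \<noteq> []" using assms(2) by (auto simp: runs_def)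
  obtain e p ys where z: "z = replicate e p @ ys" "runs ys = runs z - 1" "e > 0" "ys \<noteq> [] \<longrightarrow> hd ys \<noteq> p"
    using split_first_run[of z UNIV undefined] \<open>z \<noteq> []\<close> by auto
  have "ys \<noteq> []" using z(2) assms(2) by (auto simp: runs_def)
  then obtain x ys' where ys: "ys = x # ys'" "x \<noteq> p" using z(4) by (cases ys) auto
  obtain e' where e: "e = Suc e'" using z(3) gr0_implies_Suc by blast
  have "last ys = p" using last z(1,3) ys e by (simp add: hd_append)
  then have ys_snoc: "ys = x # butlast ys' @ [p]"
    using ys by (metis append_butlast_last_id last.simps)
  have "(p # replicate e' p @ ys, x # ys' @ replicate e p) \<in> shortlex r"
    using ConjSL_rotate[of "replicate e p" ys] assms(1) z(1) ys e by simp
  from shortlex_Cons_same_length[OF this]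
  have px: "(p, x) \<in> r - Id"
    using ys by (simp add: e)
  have "(replicate e p @ x # butlast ys' @ [p], replicate e p @ p # x # butlast ys') \<in> shortlex r"
    using ConjSL_rotate[of "replicate e p @ x # butlast ys'" "[p]"] assms(1) z(1) ys_snoc
    by (simp add: replicate_app_Cons_same[symmetric])
  from shortlex_append_Cons[OF this] have "(x, p) \<in> r - Id"
    using ys by simp
  then show False using px strict_antisym by blast
qed

lemma ex_square_word_in_ConjSL:
  assumes i: "even i" "i \<ge> 3"
  shows "\<exists>p\<in>{1..n}. \<exists>x\<in>{1..n}. ((p, True), (x, True)) \<in> r - Id \<and> pos_word (square_word i p x) \<in> ConjSL n m r"
proof -
  obtain a b where ab: "a \<in> {1..n}" "b \<in> {1..n}" "a \<noteq> b" and max: "\<And>u v. K u v \<le> K a b"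
    using ex_max_K by blast
  define w where "w = pos_word (square_word i a b)"
  have "square_word i a b \<in> lists {1..n}" using ab by (auto simp: square_word_def in_lists_conv_set)
  then have w: "w \<in> words" by (simp only: w_def pos_word_in_iff)
  have len_w: "length (square_word i a b) = 4 * i" by (simp add: square_word_def)
  have "finite (letters {1..n} :: nat letter set)" by (simp add: letters_def)
  then obtain z where z: "shortlex_least r {v \<in> words. conj_words w v} z"
    using ex_shortlex_least[OF lin, of "{v \<in> words. conj_words w v}" w] w conj_words_refl by blast
  then have zw: "z \<in> words" "conj_words w z" by (auto simp: shortlex_least_def)
  have z_ConjSL: "z \<in> ConjSL n m r"
    using ConjSL_iff z zw unfolding shortlex_least_def
    by (metis (mono_tags, lifting) conj_words_refl conj_words_trans mem_Collect_eq)
  \<comment> \<open>The exponent sum is a conjugacy invariant and \<open>z\<close> is no longer than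
    \<open>w\<close>, so \<open>z\<close> has length exactly \<open>4 * i\<close> and is
    positive.\<close>
  have "exponent_sum z = int (4 * i)"
    using exponent_sum_conj[OF zw(2)] len_w by (simp add: w_def)
  moreover have "(z, w) \<in> shortlex r" using z w conj_words_refl by (auto simp: shortlex_least_def)
  then have "length z \<le> 4 * i" using len_w by (auto simp: shortlex_def w_def dest: lenlex_length)
  ultimately have "exponent_sum z = int (length z)" and len_z: "length z = 4 * i"
    using exponent_sum_le[of z] by linarith+
  then obtain zs where zs: "z = pos_word zs" using pos_word_of_exponent_sum by blast
  have zs_in: "set zs \<subseteq> {1..n}" using zw(1) zs by auto
  have len_zs: "length zs = 4 * i" using len_z zs by simp
  have tr: "op_trace n (rep n K s (pos_word zs)) = op_trace n (rep n K s (pos_word (square_word i a b)))"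
    if "s \<noteq> 0" for s
    using op_trace_conj[OF zw(2) w that] by (simp add: zs w_def)
  obtain u where u: "changes (u # zs @ [u]) \<le> 4"
    using few_changes[OF ab K_sym K_ge_1[OF ab] abs_cox_cos_le _ _ zs_in len_zs tr] i by auto
  have zs_ne: "zs \<noteq> []" using len_zs i by auto
  \<comment> \<open>Since the two ends of \<open>zs\<close> differ, four changes of the closed-up
    word leave at most three inside \<open>zs\<close>, that is, four runs.\<close>
  have "runs zs \<le> 4"
  proof (cases "runs zs \<ge> 2")
    case True
    have "changes (pos_word xs) = changes xs" for xs :: "nat list"
      by (induction xs rule: changes.induct) auto
    then have "runs z = runs zs" by (simp add: runs_def zs pos_word_def)
    then have "last z \<noteq> hd z" using ConjSL_last[OF z_ConjSL] True by simp
    then have "hd zs \<noteq> last zs" using zs_ne by (auto simp: zs pos_word_def last_map hd_map)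
    then have "changes zs \<le> 3" using changes_close[of zs u 3] zs_ne u by simp
    then show ?thesis by (simp add: runs_def)
  qed simp
  then obtain e p f x g y h t where sub: "{p, x, y, t} \<subseteq> {1..n}"
    and zs4: "zs = replicate e p @ replicate f x @ replicate g y @ replicate h t"
    using split_four_runs[OF zs_in ab(1)] by metis
  have sub': "{a, b, a, b} \<subseteq> {1..n}" using ab by simp
  \<comment> \<open>Real parts of the two traces at \<open>s = \<i>\<close>; the constant
    \<open>n\<close> cancels, and for \<open>w\<close> the nonadjacent terms vanish as they pair a
    letter with itself.\<close>
  have "real e * f * g * h * K p x * K x y * K y t * K t p
    - (real e * f * (K p x)\<^sup>2 + real f * g * (K x y)\<^sup>2 + real g * h * (K y t)\<^sup>2 + real h * e * (K t p)\<^sup>2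
      + real e * g * (K p y)\<^sup>2 + real f * h * (K x t)\<^sup>2) =
    real i ^ 4 * K a b ^ 4 - 4 * (real i)\<^sup>2 * (K a b)\<^sup>2"
    using arg_cong[where f = Re, OF tr[of \<i>, unfolded zs4 square_word_def]]
    unfolding Re_trace_unipotent[OF sub K_sym K_diag] Re_trace_unipotent[OF sub' K_sym K_diag]
    by (simp add: K_sym[of b a] K_diag power4_eq_xxxx power2_eq_square algebra_simps)
  moreover have "real e + f + g + h = 4 * real i"
    using len_zs unfolding zs4 by (simp flip: of_nat_add of_nat_mult)
  ultimately have "real e = i" "real f = i" "real g = i" "real h = i" "K p y = 0" "K x t = 0" "K p x \<noteq> 0"
    using four_exponents_rigid[of e f g h i "K p x" "K x y" "K y t" "K t p" "K a b" "K p y" "K x t"]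
      K_nonneg max K_ge_1[OF ab] i(2) by auto
  \<comment> \<open>Distinct generators have \<open>K\<close> at least 1, so the vanishing of
    \<open>K p y\<close> and \<open>K x t\<close> identifies the letters.\<close>
  moreover have "p = y" "x = t" using calculation K_ge_1[of p y] K_ge_1[of x t] sub by auto
  ultimately have zs': "zs = square_word i p x" and px: "p \<noteq> x"
    using K_diag by (auto simp: zs4 square_word_def)
  obtain i' where i': "i = Suc i'" using i by (cases i) auto
  have "pos_word (replicate i p) @ pos_word (replicate i x @ replicate i p @ replicate i x) \<in> ConjSL n m r"
    using z_ConjSL by (simp add: zs zs' square_word_def)
  \<comment> \<open>Rotation by one syllable gives a word starting with \<open>x\<close>, so
    minimality decides the order of the two letters.\<close>
  from ConjSL_rotate[OF this]
  have "((p, True) # replicate i' (p, True) @ replicate i (x, True) @ replicate i (p, True) @ replicate i (x, True),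
      (x, True) # replicate i' (x, True) @ replicate i (p, True) @ replicate i (x, True) @ replicate i (p, True))
    \<in> shortlex r" by (simp add: i')
  from shortlex_Cons_same_length[OF this] have "((p, True), (x, True)) \<in> r - Id"
    using px by simp
  moreover have "pos_word (square_word i p x) \<in> ConjSL n m r" using z_ConjSL zs zs' by simp
  ultimately show ?thesis using sub by blast
qed

section \<open>The pumping argument\<close>

lemma ConjSL_not_regular: "\<not> regular_language (letters {1..n}) (ConjSL n m r)"
proof
  assume "regular_language (letters {1..n}) (ConjSL n m r)"
  then obtain Q :: "nat set" and q0 F \<delta> where Q: "finite Q" "q0 \<in> Q" "\<forall>q\<in>Q. \<forall>x\<in>letters {1..n}. \<delta> q x \<in> Q"
    and L: "ConjSL n m r = {w \<in> words. foldl \<delta> q0 w \<in> F}"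
    unfolding regular_language_def by blast
  define I where "I = {i :: nat. even i \<and> i \<ge> 3}"
  have "\<exists>p x. p \<in> {1..n} \<and> x \<in> {1..n} \<and> ((p, True), (x, True)) \<in> r - Id \<and>
      pos_word (square_word i p x) \<in> ConjSL n m r" if "i \<in> I" for i
    using ex_square_word_in_ConjSL[of i] that unfolding I_def by blast
  then obtain p x where px: "\<And>i. i \<in> I \<Longrightarrow> p i \<in> {1..n} \<and> x i \<in> {1..n} \<and>
      ((p i, True), (x i, True)) \<in> r - Id \<and> pos_word (square_word i (p i) (x i)) \<in> ConjSL n m r"
    by metis
  \<comment> \<open>The pigeonhole is applied to both letters together with the state reached after
    the first syllable, so that the two exponents found share the same letters.\<close>
  define st where "st i = (p i, x i, foldl \<delta> q0 (replicate i (p i, True)))" for i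
  have run: "q \<in> Q \<Longrightarrow> w \<in> words \<Longrightarrow> foldl \<delta> q w \<in> Q" for q w
    using Q(3) by (induction w arbitrary: q) auto
  have "st ` I \<subseteq> {1..n} \<times> {1..n} \<times> Q"
    using px run[OF Q(2)] by (force simp: st_def letters_def)
  then have "finite (st ` I)" by (rule finite_subset) (simp add: Q(1))
  moreover have "infinite I"
  proof
    assume "finite I"
    moreover have "(\<lambda>k. 2 * k + 4) ` UNIV \<subseteq> I" by (auto simp: I_def)
    ultimately have "finite (range (\<lambda>k :: nat. 2 * k + 4))" by (rule finite_subset[rotated])
    then have "finite (UNIV :: nat set)" by (rule finite_imageD) (simp add: inj_def)
    then show False by simp
  qed
  ultimately have "\<not> inj_on st I" using finite_imageD by blast
  then obtain i j where ij: "i \<in> I" "j \<in> I" "st i = st j" "i < j"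
    unfolding inj_on_def by (metis linorder_neq_iff)
  define P where "P = (p j, True)"
  define X where "X = (x j, True)"
  have PX: "P \<in> letters {1..n}" "X \<in> letters {1..n}" "(P, X) \<in> r - Id"
    using px[OF ij(2)] by (auto simp: P_def X_def letters_def)
  have "replicate j P @ replicate j X @ replicate j P @ replicate j X \<in> ConjSL n m r"
    using px[OF ij(2)] by (simp add: square_word_def P_def X_def)
  moreover have "foldl \<delta> q0 (replicate i P) = foldl \<delta> q0 (replicate j P)"
    using ij(3) unfolding st_def P_def prod.inject by metis
  \<comment> \<open>The first syllable of the square word for \<open>j\<close> is shortened to
    \<open>i\<close> without changing the state reached.\<close>
  ultimately have "(replicate i P @ replicate j X) @ (replicate j P @ replicate j X) \<in> ConjSL n m r"
    using PX by (auto simp: L in_lists_conv_set)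
  from ConjSL_rotate[OF this]
  have rot: "(replicate i P @ replicate j X @ replicate j P @ replicate j X,
      replicate j P @ replicate j X @ replicate i P @ replicate j X) \<in> shortlex r" by simp
  obtain d where d: "j = i + Suc d" using ij(4) less_iff_Suc_add by auto
  have X: "replicate i P @ X # replicate (i + d) X @ u = replicate i P @ replicate j X @ u" for u
    by (simp add: d)
  have "replicate j P = replicate i P @ replicate (Suc d) P" unfolding d by (rule replicate_add)
  then have P: "replicate i P @ P # replicate d P @ u = replicate j P @ u" for u
    by simp
  \<comment> \<open>After the common prefix \<open>replicate i P\<close>, the accepted word
    continues with \<open>X\<close> and its rotation with \<open>P\<close>, as
    \<open>i < j\<close>.\<close>
  have "(X, P) \<in> r - Id"
  proof (rule shortlex_append_Cons)
    show "(replicate i P @ X # replicate (i + d) X @ replicate j P @ replicate j X,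
      replicate i P @ P # replicate d P @ replicate j X @ replicate i P @ replicate j X) \<in> shortlex r"
      unfolding X P by (rule rot)
    show "X \<noteq> P" using PX by auto
  qed (simp add: d)
  then show False using PX(3) strict_antisym by blast
qed

end

end

theorem theorem3p12:
  fixes n :: nat
    and m :: "nat \<Rightarrow> nat \<Rightarrow> enat"
    and r :: "(nat letter \<times> nat letter) set"
  assumes "n \<ge> 2"
    and "coxeter_matrix n m"
    and "large_type n m"
    and "linear_order_on (letters {1..n}) r"
  shows "\<not> regular_language (letters {1..n}) (ConjSL n m r)"
proof -
  interpret large_artin n m
    by unfold_locales (use assms artin_relations_words in auto)
  show ?thesis
    using assms(4) by (rule ConjSL_not_regular)
qed

end
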